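(* There exists an FPTAS for the robust optimization problem $\max_{p\in\Delta(\mathcal{I})}\min_{k\in[n]}\sum_{X\in\mathcal{I}}p_Xf_k(X)$ when $f_1,\dots,f_n$ are monotone linear and $\mathcal{I}$ is defined by a knapsack constraint: for every $\epsilon>0$ it outputs $p\in\Delta(\mathcal{I})$ whose worst-case value is at least $(1-\epsilon)$ times the optimum, in time polynomial in the input size and $1/\epsilon$.
   Context: $f_k(X)=\sum_{e\in X}w_{ke}$ with $w_{ke}\ge0$; $\mathcal{I}=\{X\subseteq E:\sum_{e\in X}s(e)\le C\}$ for item sizes $s(e)$ and capacity $C$; $\Delta(\mathcal{I})$ is the set of probability distributions over $\mathcal{I}$. *)

theory Defs
  imports "HOL-Probability.Probability_Mass_Function" "HOL-Library.Log_Nat"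
begin

section \<open>Model of computation\<close>

text \<open>
  Running time is measured on a random access machine over the integers with logarithmic cost,
  presented as a structured language.  Memory consists of integer arrays, finitely many of which
  are named by a given program.  Every operation is charged for the bit lengths of the addresses
  and operands involved (multiplication and division: the product of the operand lengths, as for
  the schoolbook methods), so that polynomial time is polynomial time on a Turing machine.
\<close>

type_synonym array = string
type_synonym store = "array \<Rightarrow> int \<Rightarrow> int"

text \<open>One bit is reserved for the sign, so every integer has positive length.\<close>
definition bits :: "int \<Rightarrow> nat" where
  "bits z = 1 + floorlog 2 (nat \<bar>z\<bar>)"

datatype aexp =
    Num int
  | Read array aexp
  | Plus aexp aexp
  | Minus aexp aexp
  | Times aexp aexp
  | Quot aexp aexp

fun aval :: "aexp \<Rightarrow> store \<Rightarrow> int" where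
  "aval (Num z) s = z"
| "aval (Read x a) s = s x (aval a s)"
| "aval (Plus a b) s = aval a s + aval b s"
| "aval (Minus a b) s = aval a s - aval b s"
| "aval (Times a b) s = aval a s * aval b s"
| "aval (Quot a b) s = aval a s div aval b s"

fun acost :: "aexp \<Rightarrow> store \<Rightarrow> nat" where
  "acost (Num z) s = bits z"
| "acost (Read x a) s = acost a s + bits (aval a s) + bits (s x (aval a s))"
| "acost (Plus a b) s = acost a s + acost b s + bits (aval a s) + bits (aval b s)"
| "acost (Minus a b) s = acost a s + acost b s + bits (aval a s) + bits (aval b s)"
| "acost (Times a b) s = acost a s + acost b s + bits (aval a s) * bits (aval b s)"
| "acost (Quot a b) s = acost a s + acost b s + bits (aval a s) * bits (aval b s)"

datatype bexp =
    Less aexp aexp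
  | Neg bexp
  | Conj bexp bexp

fun bval :: "bexp \<Rightarrow> store \<Rightarrow> bool" where
  "bval (Less a b) s \<longleftrightarrow> aval a s < aval b s"
| "bval (Neg b) s \<longleftrightarrow> \<not> bval b s"
| "bval (Conj b c) s \<longleftrightarrow> bval b s \<and> bval c s"

fun bcost :: "bexp \<Rightarrow> store \<Rightarrow> nat" where
  "bcost (Less a b) s = acost a s + acost b s + bits (aval a s) + bits (aval b s)"
| "bcost (Neg b) s = 1 + bcost b s"
| "bcost (Conj b c) s = 1 + bcost b s + bcost c s"

datatype com =
    Skip
  | Write array aexp aexp
  | Seq com com
  | If bexp com com
  | While bexp com

text \<open>\<open>exec c s t s'\<close>: started in \<open>s\<close>, the program \<open>c\<close> halts in \<open>s'\<close> at total cost \<open>t\<close>.\<close>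
inductive exec :: "com \<Rightarrow> store \<Rightarrow> nat \<Rightarrow> store \<Rightarrow> bool" where
  Skip: "exec Skip s 1 s"
| Write: "exec (Write x a b) s
    (1 + acost a s + acost b s + bits (aval a s) + bits (aval b s))
    (s(x := (s x)(aval a s := aval b s)))"
| Seq: "exec c1 s t1 s' \<Longrightarrow> exec c2 s' t2 s'' \<Longrightarrow> exec (Seq c1 c2) s (t1 + t2) s''"
| IfTrue: "bval b s \<Longrightarrow> exec c1 s t s' \<Longrightarrow> exec (If b c1 c2) s (1 + bcost b s + t) s'"
| IfFalse: "\<not> bval b s \<Longrightarrow> exec c2 s t s' \<Longrightarrow> exec (If b c1 c2) s (1 + bcost b s + t) s'"
| WhileFalse: "\<not> bval b s \<Longrightarrow> exec (While b c) s (1 + bcost b s) s"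
| WhileTrue: "bval b s \<Longrightarrow> exec c s t1 s' \<Longrightarrow> exec (While b c) s' t2 s'' \<Longrightarrow>
    exec (While b c) s (1 + bcost b s + t1 + t2) s''"

inductive_cases exec_SkipE: "exec Skip s t s'"
inductive_cases exec_WriteE: "exec (Write x a b) s t s'"
inductive_cases exec_SeqE: "exec (Seq c1 c2) s t s'"
inductive_cases exec_IfE: "exec (If b c1 c2) s t s'"
inductive_cases exec_WhileE: "exec (While b c) s t s'"

lemma exec_deterministic:
  "exec c s t s' \<Longrightarrow> exec c s u r \<Longrightarrow> u = t \<and> r = s'"
proof (induction arbitrary: u r rule: exec.induct)
  case (Skip s)
  then show ?case by (auto elim: exec_SkipE)
next
  case (Write x a b s)
  then show ?case by (auto elim: exec_WriteE)
next
  case (Seq c1 s t1 s' c2 t2 s'')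
  from Seq.prems show ?case
  proof (rule exec_SeqE)
    fix v1 r' v2
    assume u: "u = v1 + v2" and 1: "exec c1 s v1 r'" and 2: "exec c2 r' v2 r"
    from Seq.IH(1)[OF 1] have eq: "v1 = t1" "r' = s'" by simp_all
    from Seq.IH(2)[OF 2[unfolded eq]] show ?thesis
      unfolding u eq by simp
  qed
next
  case (IfTrue b s c1 t s' c2)
  from IfTrue.prems show ?case
  proof (rule exec_IfE)
    fix v
    assume u: "u = Suc (bcost b s + v)" and 1: "exec c1 s v r"
    from IfTrue.IH[OF 1] show ?thesis unfolding u by simp
  qed (use IfTrue.hyps(1) in simp)
next
  case (IfFalse b s c2 t s' c1)
  from IfFalse.prems show ?case
  proof (rule exec_IfE)
    fix v
    assume u: "u = Suc (bcost b s + v)" and 1: "exec c2 s v r"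
    from IfFalse.IH[OF 1] show ?thesis unfolding u by simp
  qed (use IfFalse.hyps(1) in simp)
next
  case (WhileFalse b s c)
  from WhileFalse.prems show ?case
    by (rule exec_WhileE) (use WhileFalse.hyps(1) in simp_all)
next
  case (WhileTrue b s c t1 s' t2 s'')
  from WhileTrue.prems show ?case
  proof (rule exec_WhileE)
    fix v1 r' v2
    assume u: "u = Suc (bcost b s + v1 + v2)"
      and 1: "exec c s v1 r'" and 2: "exec (While b c) r' v2 r"
    from WhileTrue.IH(1)[OF 1] have eq: "v1 = t1" "r' = s'" by simp_all
    from WhileTrue.IH(2)[OF 2[unfolded eq]] show ?thesis
      unfolding u eq by simp
  qed (use WhileTrue.hyps(1) in simp)
qed

section \<open>The robust knapsack problem\<close>

text \<open>
  Objectives are indexed by \<open>{..<objectives I}\<close> and items by \<open>{..<items I}\<close>; the functions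
  \<open>weight\<close> and \<open>item_size\<close> are relevant only on these index sets.  The data are rational because
  they have to be given to an algorithm.
\<close>
record instance_data =
  objectives :: nat
  items :: nat
  weight :: "nat \<Rightarrow> nat \<Rightarrow> rat"
  item_size :: "nat \<Rightarrow> rat"
  capacity :: rat

definition valid_instance :: "instance_data \<Rightarrow> bool" where
  "valid_instance I \<longleftrightarrow>
     1 \<le> objectives I \<and>
     (\<forall>k<objectives I. \<forall>e<items I. 0 \<le> weight I k e) \<and>
     (\<forall>e<items I. 0 \<le> item_size I e) \<and>
     0 \<le> capacity I"

definition feasible_sets :: "instance_data \<Rightarrow> nat set set" where
  "feasible_sets I = {X. X \<subseteq> {..<items I} \<and> (\<Sum>e\<in>X. item_size I e) \<le> capacity I}"

definition objective :: "instance_data \<Rightarrow> nat \<Rightarrow> nat set \<Rightarrow> real" where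
  "objective I k X = (\<Sum>e\<in>X. real_of_rat (weight I k e))"

definition distributions :: "instance_data \<Rightarrow> nat set pmf set" where
  "distributions I = {p. set_pmf p \<subseteq> feasible_sets I}"

definition worst_case :: "instance_data \<Rightarrow> nat set pmf \<Rightarrow> real" where
  "worst_case I p =
     (MIN k\<in>{..<objectives I}. \<Sum>X\<in>feasible_sets I. pmf p X * objective I k X)"

definition optimum :: "instance_data \<Rightarrow> real" where
  "optimum I = (SUP p\<in>distributions I. worst_case I p)"

lemma worst_case_le_optimum:
  assumes "valid_instance I" and "p \<in> distributions I"
  shows "worst_case I p \<le> optimum I"
proof -
  have fin: "finite (feasible_sets I)"
    by (rule finite_subset[of _ "Pow {..<items I}"]) (auto simp: feasible_sets_def)
  have nonneg: "0 \<le> objective I 0 X" if "X \<in> feasible_sets I" for X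
    using assms(1) that unfolding objective_def valid_instance_def feasible_sets_def
    by (intro sum_nonneg) auto
  have "worst_case I q \<le> (\<Sum>X\<in>feasible_sets I. objective I 0 X)" for q
  proof -
    have "worst_case I q \<le> (\<Sum>X\<in>feasible_sets I. pmf q X * objective I 0 X)"
      using assms(1) unfolding worst_case_def valid_instance_def by (intro Min_le) auto
    also have "\<dots> \<le> (\<Sum>X\<in>feasible_sets I. objective I 0 X)"
      by (intro sum_mono mult_left_le_one_le nonneg) (auto simp: pmf_le_1)
    finally show ?thesis .
  qed
  then have "bdd_above (worst_case I ` distributions I)"
    by (intro bdd_aboveI2)
  then show ?thesis
    unfolding optimum_def using assms(2) by (rule cSUP_upper2) simp
qed

section \<open>Input and output conventions\<close>

definition encode_rat :: "rat \<Rightarrow> int list" where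
  "encode_rat r = [fst (quotient_of r), snd (quotient_of r)]"

definition encode_instance :: "instance_data \<Rightarrow> int list" where
  "encode_instance I =
     [int (objectives I), int (items I)] @ encode_rat (capacity I) @
     concat (map (\<lambda>e. encode_rat (item_size I e)) [0..<items I]) @
     concat (map (\<lambda>k. concat (map (\<lambda>e. encode_rat (weight I k e)) [0..<items I]))
       [0..<objectives I])"

definition input_size :: "instance_data \<Rightarrow> nat" where
  "input_size I = (\<Sum>z\<leftarrow>encode_instance I. bits z)"

text \<open>
  A real number \<open>\<epsilon>\<close> is not a finite object; the machine is given the integer \<open>\<lceil>1/\<epsilon>\<rceil>\<close> in its place.
\<close>
definition initial_store :: "instance_data \<Rightarrow> real \<Rightarrow> store" where
  "initial_store I \<epsilon> = (\<lambda>x i.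
     if x = ''input'' \<and> 0 \<le> i \<and> i < int (length (encode_instance I))
       then encode_instance I ! nat i
     else if x = ''precision'' \<and> i = 0 then \<lceil>1 / \<epsilon>\<rceil>
     else 0)"

text \<open>
  Since there may be exponentially many feasible sets, a distribution is output as an explicit
  list of sets with rational probabilities.  Cell 0 of the array \<open>output\<close> holds the number of
  entries; each entry occupies \<open>items I + 2\<close> cells: numerator and denominator of the probability,
  then the characteristic vector of the set.  A set may be listed repeatedly, in which case its
  probabilities add up.  As unwritten cells contain 0, positivity of the denominators
  forces every entry to have been written by the program.
\<close>
definition entry_cell :: "instance_data \<Rightarrow> store \<Rightarrow> nat \<Rightarrow> nat \<Rightarrow> int" where
  "entry_cell I s i j = s ''output'' (1 + int (i * (items I + 2) + j))"

definition entry_prob :: "instance_data \<Rightarrow> store \<Rightarrow> nat \<Rightarrow> real" where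
  "entry_prob I s i = real_of_int (entry_cell I s i 0) / real_of_int (entry_cell I s i 1)"

definition entry_set :: "instance_data \<Rightarrow> store \<Rightarrow> nat \<Rightarrow> nat set" where
  "entry_set I s i = {e. e < items I \<and> entry_cell I s i (2 + e) = 1}"

definition outputs_distribution :: "instance_data \<Rightarrow> store \<Rightarrow> nat set pmf \<Rightarrow> bool" where
  "outputs_distribution I s p \<longleftrightarrow>
     (\<exists>l. s ''output'' 0 = int l \<and>
        (\<forall>i<l. 0 \<le> entry_cell I s i 0 \<and> 0 < entry_cell I s i 1) \<and>
        (\<forall>X. pmf p X = (\<Sum>i | i < l \<and> entry_set I s i = X. entry_prob I s i)))"

text \<open>
  The exponent and constant are independent of the instance and of \<open>\<epsilon>\<close>.  Every polynomial in two
  nonnegative variables \<open>x\<close>, \<open>y\<close> is bounded by some \<open>a * (1 + x + y) ^ d\<close>, so this is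
  running time polynomial in the input size and \<open>1/\<epsilon>\<close>.
\<close>
definition is_robust_knapsack_fptas :: "com \<Rightarrow> bool" where
  "is_robust_knapsack_fptas c \<longleftrightarrow>
     (\<exists>(a::real) (d::nat). \<forall>I (\<epsilon>::real). valid_instance I \<longrightarrow> 0 < \<epsilon> \<longrightarrow>
        (\<exists>t s p. exec c (initial_store I \<epsilon>) t s \<and>
           real t \<le> a * (1 + real (input_size I) + 1 / \<epsilon>) ^ d \<and>
           outputs_distribution I s p \<and>
           p \<in> distributions I \<and>
           worst_case I p \<ge> (1 - \<epsilon>) * optimum I))"

end

theory Submission
  imports Defs
begin

text \<open>
  Let \<open>\<mu>\<close> be the least, over the objectives, of the largest weight of an item that fits.  The optimum
  lies between \<open>\<mu>/n\<close> and \<open>m\<mu>\<close>.  Hence weights can be rounded down to multiples of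
  \<open>\<delta> = \<mu>/(4nm\<lceil>1/\<epsilon>\<rceil>)\<close>, and also capped at \<open>(4nm\<lceil>1/\<epsilon>\<rceil>)\<^sup>2 \<delta>\<close>: mixing an optimal distribution with
  a little of the best singletons serves every objective with a capped weight.  This leaves integer
  weights of polynomial size and allows a constant additive error.

  The resulting game is solved by Blackwell's approachability.  Each objective \<open>k\<close> carries a deficit
  \<open>y\<^sub>k \<ge> 1\<close>; an exact, pseudopolynomial dynamic program finds the set maximising the gain weighted by
  \<open>y\<close>, and the maximum divided by \<open>\<Sum>\<^sub>k y\<^sub>k\<close> is the target of the round, which is at least the value of
  the game.  Adding target minus gain to each \<open>y\<^sub>k\<close> increases \<open>\<Sum>\<^sub>k y\<^sub>k\<^sup>2\<close> by a bounded amount per round,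
  so after polynomially many rounds every deficit is at most the number of rounds, and the uniform
  distribution on the chosen sets is nearly optimal.

  The program consists of loops whose number of iterations is known in advance, so its cost is
  polynomial as soon as these numbers and the lengths of all stored integers are.
\<close>

section \<open>Execution within resource bounds\<close>

text \<open>Multiplicative weights, the usual choice for such a game, can become exponentially
  large, too large for weighted values to index a table. The additive update keeps every deficit an
  integer of polynomial magnitude. Rounding item sizes could destroy feasibility, so sizes stay
  exact; they occur only as table entries, where exponential magnitude is harmless. Hence two
  resources are kept apart: \<open>R\<close>, polynomial, bounds loop counts and weighted values,
  while \<open>B\<close>, of polynomial length only, bounds cell contents. The optimum enters
  through weak duality: a \<open>V\<close> that dominates the \<open>y\<close>-weighted gain of
  every feasible set dominates that of every mixture. So the mixture of an optimal distribution with
  the best singletons occurs only in the analysis; the program never computes it. With K =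
  4\<lceil>1/\<epsilon>\<rceil>, the mixture costs a fraction 1/K of the optimum. The additive
  errors of rounding and of the dynamics are charged to the value that the singletons alone
  guarantee; in total at most a fraction 4/K is lost, which explains the 4 in \<delta>.\<close>

lemma bits_le_iff: "bits z \<le> Suc k \<longleftrightarrow> \<bar>z\<bar> < 2 ^ k"
proof -
  have "bits z \<le> Suc k \<longleftrightarrow> floorlog 2 (nat \<bar>z\<bar>) \<le> k" by (simp add: bits_def)
  also have "\<dots> \<longleftrightarrow> nat \<bar>z\<bar> < 2 ^ k"
    using floorlog_leD[of 2 "nat \<bar>z\<bar>" k] floorlog_leI[of "nat \<bar>z\<bar>" 2 k]
    by (cases "nat \<bar>z\<bar> = 0") (auto simp: floorlog_def)
  also have "\<dots> \<longleftrightarrow> \<bar>z\<bar> < 2 ^ k" by (simp add: nat_less_iff)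
  finally show ?thesis .
qed

lemma bits_pos [simp]: "0 < bits z"
  by (simp add: bits_def)

lemma abs_less_bits: "\<bar>z\<bar> < 2 ^ (bits z - 1)"
  using bits_le_iff[of z "bits z - 1"] by simp

lemma bits_mono: "\<bar>a\<bar> \<le> \<bar>b\<bar> \<Longrightarrow> bits a \<le> bits b"
  using bits_le_iff[of a "bits b - 1"] abs_less_bits[of b] by simp

lemma bits_mult: "bits (a * b) \<le> bits a + bits b"
proof -
  have "\<bar>a * b\<bar> < 2 ^ (bits a - 1) * 2 ^ (bits b - 1)"
    unfolding abs_mult by (intro mult_strict_mono abs_less_bits) auto
  then have "bits (a * b) \<le> Suc (bits a - 1 + (bits b - 1))"
    by (simp add: bits_le_iff power_add)
  then show ?thesis using bits_pos[of a] bits_pos[of b] by linarith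
qed

lemma bits_add: "bits (a + b) \<le> bits a + bits b"
proof -
  have p: "(1::int) \<le> 2 ^ i" for i :: nat by simp
  \<comment> \<open>Bounding the sum by twice the product gives addition the same additive length
    rule as multiplication.\<close>
  have "x + y \<le> 2 * (x * y)" if "1 \<le> x" "1 \<le> y" for x y :: int
  proof -
    have "0 \<le> x * (y - 1) + y * (x - 1)" using that by simp
    then show ?thesis by (simp add: algebra_simps)
  qed
  from this[OF p[of "bits a - 1"] p[of "bits b - 1"]]
  have "\<bar>a + b\<bar> < 2 * (2 ^ (bits a - 1) * 2 ^ (bits b - 1))"
    using abs_less_bits[of a] abs_less_bits[of b] by linarith
  then have "bits (a + b) \<le> Suc (Suc (bits a - 1 + (bits b - 1)))"
    by (simp add: bits_le_iff power_add)
  then show ?thesis using bits_pos[of a] bits_pos[of b] by linarith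
qed

lemma bits_minus: "bits (- a) = bits a"
  by (simp add: bits_def)

text \<open>Floor division rounds negative quotients away from zero, but for an integer numerator
  the absolute value still cannot grow; division by 0 yields 0.\<close>

lemma bits_div: "bits (a div b) \<le> bits a"
proof (rule bits_mono)
  have pos: "\<bar>a div c\<bar> \<le> \<bar>a\<bar>" if "0 < c" for a c :: int
  proof (cases "0 \<le> a")
    case True
    then show ?thesis using that zdiv_mono2[of a 1 c] by (simp add: pos_imp_zdiv_nonneg_iff)
  next
    case False
    then show ?thesis using that zdiv_mono2_neg[of a 1 c] pos_imp_zdiv_neg_iff[of c a] by simp
  qed
  show "\<bar>a div b\<bar> \<le> \<bar>a\<bar>"
  proof (cases "b < 0")
    case True
    then show ?thesis using pos[of "- b" "- a"] by simp
  next
    case False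
    then show ?thesis using pos[of b a] by (cases "b = 0") auto
  qed
qed

section \<open>Syntactic bounds on lengths and costs\<close>

text \<open>Coefficient of \<open>L\<close> in the length of the value when all cells have length at
  most \<open>L\<close>. Lengths of factors add up in a product, so \<open>Times\<close> adds
  coefficients like \<open>Plus\<close>.\<close>

fun abits :: "aexp \<Rightarrow> nat" where
  "abits (Num z) = bits z"
| "abits (Read x a) = 1"
| "abits (Plus a b) = abits a + abits b"
| "abits (Minus a b) = abits a + abits b"
| "abits (Times a b) = abits a + abits b"
| "abits (Quot a b) = abits a + abits b"

text \<open>Coefficient of the square of \<open>L\<close> in the evaluation cost. A square suffices
  because the dearest primitive is charged the product of two lengths that are linear in
  \<open>L\<close>.\<close>

fun atime :: "aexp \<Rightarrow> nat" where
  "atime (Num z) = bits z"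
| "atime (Read x a) = atime a + abits a + 1"
| "atime (Plus a b) = atime a + atime b + abits a + abits b"
| "atime (Minus a b) = atime a + atime b + abits a + abits b"
| "atime (Times a b) = atime a + atime b + abits a * abits b"
| "atime (Quot a b) = atime a + atime b + abits a * abits b"

fun btime :: "bexp \<Rightarrow> nat" where
  "btime (Less a b) = atime a + atime b + abits a + abits b"
| "btime (Neg b) = 1 + btime b"
| "btime (Conj b c) = 1 + btime b + btime c"

text \<open>An upper bound on the running time when every memory cell has length at most \<open>L\<close> and every loop
  runs at most \<open>R\<close> times.\<close>
fun ctime :: "nat \<Rightarrow> nat \<Rightarrow> com \<Rightarrow> nat" where
  "ctime R L Skip = 1"
| "ctime R L (Write x a b) = 1 + (atime a + atime b + abits a + abits b) * L\<^sup>2"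
| "ctime R L (Seq c1 c2) = ctime R L c1 + ctime R L c2"
| "ctime R L (If b c1 c2) = 1 + btime b * L\<^sup>2 + ctime R L c1 + ctime R L c2"
| "ctime R L (While b c) = Suc R * (1 + btime b * L\<^sup>2 + ctime R L c)"

text \<open>Exponent of the loop bound. Loops in sequence are added as well, which overestimates the
  true nesting depth but remains a constant of the program.\<close>

fun nesting :: "com \<Rightarrow> nat" where
  "nesting (Seq c1 c2) = nesting c1 + nesting c2"
| "nesting (If b c1 c2) = nesting c1 + nesting c2"
| "nesting (While b c) = Suc (nesting c)"
| "nesting _ = 0"

text \<open>Each loop contributes a factor \<open>Suc R\<close> and each expression a factor
  quadratic in \<open>L\<close>. At \<open>R = 0\<close> and \<open>L = 1\<close> both factors are
  1, so the value there serves as the leading constant.\<close>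

lemma ctime_poly:
  assumes "1 \<le> L"
  shows "ctime R L c \<le> ctime 0 1 c * (Suc R ^ nesting c * L\<^sup>2)"
proof (induction c)
  case Skip
  then show ?case using assms by simp
next
  case (Write x a b)
  then show ?case using assms by (simp add: algebra_simps)
next
  case (Seq c1 c2)
  have "x * (Suc R ^ nesting c1 * L\<^sup>2) \<le> x * (Suc R ^ (nesting c1 + nesting c2) * L\<^sup>2)"
    "x * (Suc R ^ nesting c2 * L\<^sup>2) \<le> x * (Suc R ^ (nesting c1 + nesting c2) * L\<^sup>2)" for x
    by (intro mult_le_mono le_refl power_increasing; simp)+
  from this(1)[of "ctime 0 1 c1"] this(2)[of "ctime 0 1 c2"] Seq show ?case
    unfolding ctime.simps nesting.simps distrib_right by linarith
next
  case (If b c1 c2)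
  have "x * (Suc R ^ nesting c1 * L\<^sup>2) \<le> x * (Suc R ^ (nesting c1 + nesting c2) * L\<^sup>2)"
    "x * (Suc R ^ nesting c2 * L\<^sup>2) \<le> x * (Suc R ^ (nesting c1 + nesting c2) * L\<^sup>2)" for x
    by (intro mult_le_mono le_refl power_increasing; simp)+
  note this(1)[of "ctime 0 1 c1"] this(2)[of "ctime 0 1 c2"]
  moreover have "1 + btime b * L\<^sup>2 \<le> (1 + btime b) * (Suc R ^ (nesting c1 + nesting c2) * L\<^sup>2)"
  proof -
    have "1 + btime b * L\<^sup>2 \<le> (1 + btime b) * (1 * L\<^sup>2)" using assms by simp
    also have "\<dots> \<le> (1 + btime b) * (Suc R ^ (nesting c1 + nesting c2) * L\<^sup>2)"
      by (intro mult_le_mono le_refl) simp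
    finally show ?thesis .
  qed
  ultimately show ?case
    using If unfolding ctime.simps nesting.simps power_one mult_1_right distrib_right by linarith
next
  case (While b c)
  have "1 + btime b * L\<^sup>2 + ctime R L c \<le> (1 + btime b + ctime 0 1 c) * (Suc R ^ nesting c * L\<^sup>2)"
  proof -
    have "1 + btime b * L\<^sup>2 \<le> (1 + btime b) * (1 * L\<^sup>2)" using assms by simp
    also have "\<dots> \<le> (1 + btime b) * (Suc R ^ nesting c * L\<^sup>2)"
      by (intro mult_le_mono le_refl) simp
    finally show ?thesis using While unfolding distrib_right by linarith
  qed
  from mult_le_mono2[OF this, of "Suc R"] show ?case
    by (simp add: algebra_simps)
qed

lemma mult_le_mult_square: "1 \<le> L \<Longrightarrow> k * L \<le> k * L\<^sup>2" for L :: nat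
  by (intro mult_le_mono le_refl self_le_power) auto

lemma bits_aval:
  assumes "\<And>x i. bits (s x i) \<le> L" "1 \<le> L"
  shows "bits (aval a s) \<le> abits a * L"
proof (induction a)
  case (Num z)
  show ?case using assms(2) by simp
next
  case (Read x a)
  show ?case using assms(1) by simp
next
  case (Plus a b)
  then show ?case using bits_add[of "aval a s" "aval b s"] by (simp add: distrib_right)
next
  case (Minus a b)
  then show ?case using bits_add[of "aval a s" "- aval b s"] by (simp add: distrib_right bits_minus)
next
  case (Times a b)
  then show ?case using bits_mult[of "aval a s" "aval b s"] by (simp add: distrib_right)
next
  case (Quot a b)
  then show ?case using bits_div[of "aval a s" "aval b s"] by (simp add: distrib_right)
qed

lemma acost_le:
  assumes "\<And>x i. bits (s x i) \<le> L" "1 \<le> L"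
  shows "acost a s \<le> atime a * L\<^sup>2"
proof (induction a)
  case (Num z)
  show ?case using assms(2) by simp
next
  note LL = mult_le_mult_square[OF assms(2)]
  case (Read x a)
  show ?case using Read assms(1)[of x "aval a s"] bits_aval[of s L a, OF assms] LL[of 1] LL[of "abits a"]
    unfolding acost.simps atime.simps distrib_right by linarith
next
  note LL = mult_le_mult_square[OF assms(2)]
  case (Plus a b)
  then show ?case
    using bits_aval[of s L a, OF assms] bits_aval[of s L b, OF assms] LL[of "abits a"] LL[of "abits b"]
    unfolding acost.simps atime.simps distrib_right by linarith
next
  note LL = mult_le_mult_square[OF assms(2)]
  case (Minus a b)
  then show ?case
    using bits_aval[of s L a, OF assms] bits_aval[of s L b, OF assms] LL[of "abits a"] LL[of "abits b"]
    unfolding acost.simps atime.simps distrib_right by linarith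
next
  case (Times a b)
  then show ?case
    using mult_le_mono[OF bits_aval[of s L a, OF assms] bits_aval[of s L b, OF assms]]
    by (simp add: algebra_simps power2_eq_square)
next
  case (Quot a b)
  then show ?case
    using mult_le_mono[OF bits_aval[of s L a, OF assms] bits_aval[of s L b, OF assms]]
    by (simp add: algebra_simps power2_eq_square)
qed

lemma bits_acost_le:
  assumes "\<And>x i. bits (s x i) \<le> L" "1 \<le> L"
  shows "acost a s + bits (aval a s) \<le> (atime a + abits a) * L\<^sup>2"
  using acost_le[of s L a, OF assms] bits_aval[of s L a, OF assms]
    mult_le_mult_square[OF assms(2), of "abits a"]
  unfolding distrib_right by linarith

lemma bcost_le:
  assumes "\<And>x i. bits (s x i) \<le> L" "1 \<le> L"
  shows "bcost b s \<le> btime b * L\<^sup>2"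
proof (induction b)
  case (Less a b)
  show ?case
    using bits_acost_le[of s L a, OF assms] bits_acost_le[of s L b, OF assms]
    by (simp add: distrib_right)
next
  case (Neg b)
  have "1 \<le> L\<^sup>2" using assms(2) by simp
  with Neg show ?case by (simp add: distrib_right)
next
  case (Conj b c)
  have "1 \<le> L\<^sup>2" using assms(2) by simp
  with Conj show ?case by (simp add: distrib_right)
qed

section \<open>Framing and weakest preconditions with resources\<close>

fun reads :: "aexp \<Rightarrow> array set" where
  "reads (Num z) = {}"
| "reads (Read x a) = insert x (reads a)"
| "reads (Plus a b) = reads a \<union> reads b"
| "reads (Minus a b) = reads a \<union> reads b"
| "reads (Times a b) = reads a \<union> reads b"
| "reads (Quot a b) = reads a \<union> reads b"

fun writes :: "com \<Rightarrow> array set" where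
  "writes Skip = {}"
| "writes (Write x a b) = {x}"
| "writes (Seq c1 c2) = writes c1 \<union> writes c2"
| "writes (If b c1 c2) = writes c1 \<union> writes c2"
| "writes (While b c) = writes c"

lemma aval_cong: "(\<And>x. x \<in> reads a \<Longrightarrow> s x = s' x) \<Longrightarrow> aval a s = aval a s'"
  by (induction a) auto

lemma exec_frame: "exec c s t s' \<Longrightarrow> x \<notin> writes c \<Longrightarrow> s' x = s x"
  by (induction rule: exec.induct) auto

abbreviation Var :: "array \<Rightarrow> aexp" where
  "Var x \<equiv> Read x (Num 0)"

abbreviation Set :: "array \<Rightarrow> aexp \<Rightarrow> com" where
  "Set x a \<equiv> Write x (Num 0) a"

definition For :: "array \<Rightarrow> aexp \<Rightarrow> com \<Rightarrow> com" where
  "For x a c = Seq (Set x (Num 0)) (While (Less (Var x) a) (Seq c (Set x (Plus (Var x) (Num 1)))))"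

lemma writes_For [simp]: "writes (For x a c) = insert x (writes c)"
  by (auto simp: For_def)

text \<open>\<open>R\<close> bounds iterations and \<open>B\<close> the magnitude of cells;
  \<open>R_le_B\<close> lets loop counters be stored.\<close>

locale resources =
  fixes R :: nat and B :: int
  assumes R_le_B: "int R \<le> B"
begin

definition bounded_store :: "store \<Rightarrow> bool" where
  "bounded_store s \<longleftrightarrow> (\<forall>x i. \<bar>s x i\<bar> \<le> B)"

text \<open>Total correctness together with the static cost bound. Boundedness of the store is both
  assumed and re-established, so it never has to appear in pre- and postconditions.\<close>

definition wp :: "com \<Rightarrow> (store \<Rightarrow> bool) \<Rightarrow> store \<Rightarrow> bool" where
  "wp c Q s \<longleftrightarrow> (bounded_store s \<longrightarrow>
     (\<exists>t s'. exec c s t s' \<and> t \<le> ctime R (bits B) c \<and> bounded_store s' \<and> Q s'))"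

lemma B_nonneg: "0 \<le> B"
  using R_le_B by simp

lemma bits_bounded: "bounded_store s \<Longrightarrow> bits (s x i) \<le> bits B"
  using B_nonneg by (intro bits_mono) (auto simp: bounded_store_def)

text \<open>Composes specifications: facts about arrays that a subprogram does not write survive its
  execution without being part of its postcondition.\<close>

lemma wp_mono_frame:
  assumes "wp c P s" "\<And>s'. P s' \<Longrightarrow> \<forall>y. y \<notin> writes c \<longrightarrow> s' y = s y \<Longrightarrow> Q s'"
  shows "wp c Q s"
  using assms exec_frame unfolding wp_def by metis

lemma wp_Skip: "Q s \<Longrightarrow> wp Skip Q s"
  unfolding wp_def using exec.Skip by fastforce

text \<open>Only the value written has to fit into a cell. Intermediate results of an expression may
  exceed \<open>B\<close>; \<open>abits\<close> controls their lengths.\<close>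

lemma wp_Write:
  assumes "\<bar>aval b s\<bar> \<le> B" "Q (s(x := (s x)(aval a s := aval b s)))"
  shows "wp (Write x a b) Q s"
  unfolding wp_def
proof (intro impI exI conjI)
  assume s: "bounded_store s"
  show "exec (Write x a b) s (1 + acost a s + acost b s + bits (aval a s) + bits (aval b s))
      (s(x := (s x)(aval a s := aval b s)))"
    by (rule exec.Write)
  have "1 \<le> bits B" by (simp add: Suc_leI)
  then show "1 + acost a s + acost b s + bits (aval a s) + bits (aval b s)
      \<le> ctime R (bits B) (Write x a b)"
    using bits_acost_le[of s "bits B" a, OF bits_bounded[OF s]]
      bits_acost_le[of s "bits B" b, OF bits_bounded[OF s]]
    by (simp add: distrib_right)
  show "bounded_store (s(x := (s x)(aval a s := aval b s)))"
    using s assms(1) by (simp add: bounded_store_def)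
  show "Q (s(x := (s x)(aval a s := aval b s)))" by fact
qed

lemma wp_Seq: "wp c1 (wp c2 Q) s \<Longrightarrow> wp (Seq c1 c2) Q s"
  unfolding wp_def using exec.Seq by (metis ctime.simps(3) add_mono)

lemma wp_If:
  assumes "bval b s \<Longrightarrow> wp c1 Q s" "\<not> bval b s \<Longrightarrow> wp c2 Q s"
  shows "wp (If b c1 c2) Q s"
  unfolding wp_def
proof
  assume s: "bounded_store s"
  have "1 \<le> bits B" by (simp add: Suc_leI)
  from bcost_le[of s "bits B" b, OF bits_bounded[OF s] this]
  have cost: "bcost b s \<le> btime b * (bits B)\<^sup>2" .
  show "\<exists>t s'. exec (If b c1 c2) s t s' \<and> t \<le> ctime R (bits B) (If b c1 c2) \<and>
      bounded_store s' \<and> Q s'"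
  proof (cases "bval b s")
    case True
    from assms(1)[OF this] s obtain t s' where
      "exec c1 s t s'" "t \<le> ctime R (bits B) c1" "bounded_store s'" "Q s'"
      unfolding wp_def by auto
    with exec.IfTrue[OF True] cost show ?thesis
      by (intro exI[of _ "1 + bcost b s + t"] exI[of _ s']) auto
  next
    case False
    from assms(2)[OF this] s obtain t s' where
      "exec c2 s t s'" "t \<le> ctime R (bits B) c2" "bounded_store s'" "Q s'"
      unfolding wp_def by auto
    with exec.IfFalse[OF False] cost show ?thesis
      by (intro exI[of _ "1 + bcost b s + t"] exI[of _ s']) auto
  qed
qed

text \<open>The counter changes between two instances of the invariant, hence \<open>ins\<close>.
  The bound \<open>a\<close> must not read anything the loop writes, so that it keeps its initial
  value \<open>N\<close>.\<close>

lemma wp_For: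
  assumes x: "x \<notin> writes c" "reads a \<inter> insert x (writes c) = {}"
    and N: "aval a s = int N" "N \<le> R"
    and ins: "\<And>k s v. Inv k (s(x := v)) \<longleftrightarrow> Inv k s"
    and init: "Inv 0 s"
    and step: "\<And>k s'. k < N \<Longrightarrow> Inv k s' \<Longrightarrow> s' x 0 = int k \<Longrightarrow>
      \<forall>y. y \<notin> insert x (writes c) \<longrightarrow> s' y = s y \<Longrightarrow> wp c (Inv (Suc k)) s'"
    and post: "\<And>s'. Inv N s' \<Longrightarrow> \<forall>y. y \<notin> insert x (writes c) \<longrightarrow> s' y = s y \<Longrightarrow> Q s'"
  shows "wp (For x a c) Q s"
proof -
  define W where "W = While (Less (Var x) a) (Seq c (Set x (Plus (Var x) (Num 1))))"
  let ?I = "\<lambda>k s'. Inv k s' \<and> s' x 0 = int k \<and> (\<forall>y. y \<notin> insert x (writes c) \<longrightarrow> s' y = s y) \<and>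
    bounded_store s'"
  define K where "K = 1 + btime (Less (Var x) a) * (bits B)\<^sup>2 + ctime R (bits B) (Seq c (Set x (Plus (Var x) (Num 1))))"
  have one: "1 \<le> bits B" by (simp add: Suc_leI)
  have val: "aval a s' = int N" if "\<forall>y. y \<notin> insert x (writes c) \<longrightarrow> s' y = s y" for s'
    using that x N(1) by (metis aval_cong disjoint_iff)
  \<comment> \<open>Induction on the number \<open>d\<close> of remaining iterations; the extra unit
    in \<open>Suc d\<close> pays for the final test, which fails.\<close>
  have loop: "\<exists>t r. exec W s' t r \<and> t \<le> Suc d * K \<and> ?I N r" if "?I (N - d) s'" "d \<le> N" for d s'
    using that
  proof (induction d arbitrary: s')
    case 0
    then have s': "bounded_store s'" by simp
    have "\<not> bval (Less (Var x) a) s'" using 0 val[of s'] by simp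
    from exec.WhileFalse[OF this] have "exec W s' (1 + bcost (Less (Var x) a) s') s'"
      unfolding W_def .
    with 0 bcost_le[of s' "bits B" "Less (Var x) a", OF bits_bounded[OF s'] one] show ?case
      by (intro exI[of _ "1 + bcost (Less (Var x) a) s'"] exI[of _ s'])
        (auto simp: K_def simp del: bcost.simps btime.simps)
  next
    case (Suc d)
    let ?k = "N - Suc d"
    have k: "?k < N" "Suc ?k = N - d" using Suc.prems(2) by auto
    have s': "bounded_store s'" using Suc.prems by simp
    have less: "bval (Less (Var x) a) s'" using Suc.prems val[of s'] k(1) by simp
    have "wp c (Inv (N - d)) s'"
      using step[of ?k s'] k Suc.prems(1) by simp
    then obtain t1 r1 where r1: "exec c s' t1 r1" "t1 \<le> ctime R (bits B) c" "bounded_store r1"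
      "Inv (N - d) r1"
      using Suc.prems unfolding wp_def by auto
    note fr = exec_frame[OF r1(1)]
    have x1: "r1 x 0 = int ?k" using fr[OF x(1)] Suc.prems by simp
    let ?r = "r1(x := (r1 x)(0 := int (N - d)))"
    have "wp (Set x (Plus (Var x) (Num 1))) (\<lambda>r'. r' = ?r) r1"
      using k Suc.prems(2) N(2) R_le_B x1 by (intro wp_Write) (auto simp: fun_upd_def)
    then obtain t2 where t2: "exec (Set x (Plus (Var x) (Num 1))) r1 t2 ?r"
      "t2 \<le> ctime R (bits B) (Set x (Plus (Var x) (Num 1)))" "bounded_store ?r"
      unfolding wp_def using r1(3) by auto
    have "?I (N - d) ?r"
      using r1(4) ins t2(3) fr Suc.prems by (auto simp del: fun_upd_apply) auto
    from Suc.IH[OF this Suc_leD[OF Suc.prems(2)]] obtain t r where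
      r: "exec W ?r t r" "t \<le> Suc d * K" "?I N r"
      by blast
    have "exec W s' (1 + bcost (Less (Var x) a) s' + (t1 + t2) + t) r"
      unfolding W_def
      by (rule exec.WhileTrue[OF less exec.Seq[OF r1(1) t2(1)] r(1)[unfolded W_def]])
    moreover have "1 + bcost (Less (Var x) a) s' + (t1 + t2) + t \<le> Suc (Suc d) * K"
      using bcost_le[of s' "bits B" "Less (Var x) a", OF bits_bounded[OF s'] one] r1(2) t2(2) r(2)
      by (simp add: K_def del: bcost.simps btime.simps ctime.simps(2))
    ultimately show ?case using r(3) by blast
  qed
  show ?thesis
    unfolding wp_def
  proof
    assume s: "bounded_store s"
    let ?s = "s(x := (s x)(0 := 0))"
    have "wp (Set x (Num 0)) (\<lambda>r'. r' = ?s) s"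
      using B_nonneg by (intro wp_Write) (auto simp: fun_upd_def)
    then obtain t0 where t0: "exec (Set x (Num 0)) s t0 ?s"
      "t0 \<le> ctime R (bits B) (Set x (Num 0))" "bounded_store ?s"
      unfolding wp_def using s by auto
    have "?I (N - N) ?s" using init ins t0(3) by (auto simp del: fun_upd_apply) auto
    from loop[OF this] obtain t r where r: "exec W ?s t r" "t \<le> Suc N * K" "?I N r"
      by blast
    have "t \<le> ctime R (bits B) W"
      using r(2) mult_le_mono1[of "Suc N" "Suc R" K] N(2) unfolding W_def ctime.simps(5) K_def
      by (meson Suc_le_mono le_trans)
    with t0 r have "exec (For x a c) s (t0 + t) r" "t0 + t \<le> ctime R (bits B) (For x a c)"
      unfolding For_def W_def by (auto intro: exec.Seq simp del: ctime.simps(2,5))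
    with r(3) post show "\<exists>t s'. exec (For x a c) s t s' \<and> t \<le> ctime R (bits B) (For x a c) \<and>
        bounded_store s' \<and> Q s'"
      by blast
  qed
qed

end

section \<open>Dynamic programming for the knapsack problem\<close>

text \<open>Least size of a subset of the first \<open>e\<close> items of value at least \<open>j\<close>; sizes above the capacity
  \<open>C\<close> may be replaced by \<open>C + 1\<close>.\<close>
fun min_size :: "int \<Rightarrow> (nat \<Rightarrow> int) \<Rightarrow> (nat \<Rightarrow> int) \<Rightarrow> nat \<Rightarrow> int \<Rightarrow> int" where
  "min_size C sz v 0 j = (if j \<le> 0 then 0 else C + 1)"
| "min_size C sz v (Suc e) j =
     min (min_size C sz v e j) (min_size C sz v e (max 0 (j - v e)) + sz e)"

text \<open>Replays the decisions of the recurrence: an item is taken exactly when it made the table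
  entry strictly smaller.\<close>

fun backtrack :: "int \<Rightarrow> (nat \<Rightarrow> int) \<Rightarrow> (nat \<Rightarrow> int) \<Rightarrow> nat \<Rightarrow> int \<Rightarrow> nat set" where
  "backtrack C sz v 0 j = {}"
| "backtrack C sz v (Suc e) j =
     (if min_size C sz v (Suc e) j < min_size C sz v e j
      then insert e (backtrack C sz v e (max 0 (j - v e))) else backtrack C sz v e j)"

text \<open>Mirrors an upward scan that remembers the last index within \<open>C\<close>, so
  \<open>f\<close> may be arbitrary. The default 0 is a genuine hit if
  \<open>f 0 \<le> C\<close>.\<close>

fun last_within :: "(int \<Rightarrow> int) \<Rightarrow> int \<Rightarrow> nat \<Rightarrow> int" where
  "last_within f C 0 = 0"
| "last_within f C (Suc i) = (if f (int i) \<le> C then int i else last_within f C i)"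

definition max_value :: "int \<Rightarrow> (nat \<Rightarrow> int) \<Rightarrow> (nat \<Rightarrow> int) \<Rightarrow> nat \<Rightarrow> int" where
  "max_value C sz v m = last_within (min_size C sz v m) C (Suc (nat (\<Sum>e<m. v e)))"

definition best_set :: "int \<Rightarrow> (nat \<Rightarrow> int) \<Rightarrow> (nat \<Rightarrow> int) \<Rightarrow> nat \<Rightarrow> nat set" where
  "best_set C sz v m = backtrack C sz v m (max_value C sz v m)"

lemma last_within_bounds: "0 \<le> last_within f C i \<and> last_within f C i \<le> int i - 1 \<or> last_within f C i = 0"
  by (induction i) auto

lemma last_within_greatest: "j < i \<Longrightarrow> f (int j) \<le> C \<Longrightarrow> int j \<le> last_within f C i"
  by (induction i) (auto simp: less_Suc_eq)

lemma last_within_le: "f 0 \<le> C \<Longrightarrow> f (last_within f C i) \<le> C"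
  by (induction i) auto

lemma max_value_bounds:
  assumes "\<And>e. 0 \<le> v e"
  shows "0 \<le> max_value C sz v m" "max_value C sz v m \<le> (\<Sum>e<m. v e)"
  using last_within_bounds[of "min_size C sz v m" C "Suc (nat (\<Sum>e<m. v e))"] sum_nonneg[of "{..<m}" v] assms
  unfolding max_value_def by auto

locale knapsack =
  fixes C :: int and sz v :: "nat \<Rightarrow> int"
  assumes C_nonneg: "0 \<le> C" and sz_nonneg: "\<And>e. 0 \<le> sz e" and v_nonneg: "\<And>e. 0 \<le> v e"
begin

lemma min_size_bounds: "0 \<le> min_size C sz v e j" "min_size C sz v e j \<le> C + 1"
  by (induction e arbitrary: j) (use C_nonneg sz_nonneg in \<open>auto simp: min_le_iff_disj\<close>)

lemma min_size_zero: "min_size C sz v e 0 = 0"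
  using v_nonneg sz_nonneg by (induction e) (simp_all add: max_absorb1)

text \<open>Lower-bound half of the correctness of the table. Since the table asks for value at
  least \<open>j\<close>, a demand overshot by one item is truncated to 0.\<close>

lemma min_size_le: "X \<subseteq> {..<e} \<Longrightarrow> j \<le> sum v X \<Longrightarrow> min_size C sz v e j \<le> sum sz X"
proof (induction e arbitrary: X j)
  case 0
  then show ?case by auto
next
  case (Suc e)
  then have fin: "finite X" using finite_subset by blast
  show ?case
  proof (cases "e \<in> X")
    case True
    have X: "X - {e} \<subseteq> {..<e}" using Suc.prems(1) by auto
    have "max 0 (j - v e) \<le> sum v (X - {e})"
      using Suc.prems(2) sum.remove[OF fin True, of v] v_nonneg by (auto intro: sum_nonneg)
    from Suc.IH[OF X this] show ?thesis using sum.remove[OF fin True, of sz] by simp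
  next
    case False
    then have "X \<subseteq> {..<e}" using Suc.prems(1) by (auto simp: less_Suc_eq)
    from Suc.IH[OF this Suc.prems(2)] show ?thesis by simp
  qed
qed

lemma backtrack_subset: "backtrack C sz v e j \<subseteq> {..<e}"
proof (induction e arbitrary: j)
  case (Suc e)
  from this[of j] this[of "max 0 (j - v e)"] show ?case by (auto simp del: min_size.simps)
qed simp

text \<open>Attainment half. It is restricted to entries within \<open>C\<close>, because the
  surrogate \<open>C + 1\<close> need not be the size of any set.\<close>

lemma backtrack_optimal:
  "min_size C sz v e j \<le> C \<Longrightarrow>
    sum sz (backtrack C sz v e j) = min_size C sz v e j \<and> j \<le> sum v (backtrack C sz v e j)"
proof (induction e arbitrary: j)
  case 0
  then show ?case by (auto split: if_splits)
next
  case (Suc e)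
  show ?case
  proof (cases "min_size C sz v (Suc e) j < min_size C sz v e j")
    case True
    let ?j = "max 0 (j - v e)"
    have eq: "min_size C sz v (Suc e) j = min_size C sz v e ?j + sz e" using True by auto
    with Suc.prems have "min_size C sz v e ?j \<le> C" using sz_nonneg[of e] by linarith
    note IH = Suc.IH[OF this]
    have "finite (backtrack C sz v e ?j)" "e \<notin> backtrack C sz v e ?j"
      using backtrack_subset[of e ?j] finite_subset by auto
    with True IH eq show ?thesis by (auto simp del: min_size.simps)
  next
    case False
    then have "min_size C sz v (Suc e) j = min_size C sz v e j" by auto
    with False Suc show ?thesis by (auto simp del: min_size.simps)
  qed
qed

lemma best_set_feasible: "best_set C sz v m \<subseteq> {..<m}" "sum sz (best_set C sz v m) \<le> C"
  and best_set_value: "max_value C sz v m \<le> sum v (best_set C sz v m)"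
proof -
  show "best_set C sz v m \<subseteq> {..<m}" unfolding best_set_def by (rule backtrack_subset)
  have "min_size C sz v m (max_value C sz v m) \<le> C"
    unfolding max_value_def by (rule last_within_le) (simp add: min_size_zero C_nonneg)
  from backtrack_optimal[OF this] this
  show "sum sz (best_set C sz v m) \<le> C" "max_value C sz v m \<le> sum v (best_set C sz v m)"
    unfolding best_set_def by simp_all
qed

lemma max_value_greatest:
  assumes "X \<subseteq> {..<m}" "sum sz X \<le> C"
  shows "sum v X \<le> max_value C sz v m"
proof -
  have "sum v X \<le> (\<Sum>e<m. v e)" by (rule sum_mono2) (use assms v_nonneg in auto)
  moreover have "0 \<le> sum v X" using v_nonneg by (rule sum_nonneg)
  moreover have "min_size C sz v m (sum v X) \<le> C" using min_size_le[OF assms(1), of "sum v X"] assms(2) by simp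
  ultimately show ?thesis
    using last_within_greatest[of "nat (sum v X)" "Suc (nat (\<Sum>e<m. v e))" "min_size C sz v m" C]
    unfolding max_value_def by (simp add: nat_le_iff)
qed

end

section \<open>Approachability dynamics\<close>

locale game =
  fixes n m :: nat and C :: int and sz :: "nat \<Rightarrow> int" and w :: "nat \<Rightarrow> nat \<Rightarrow> int" and W :: int
  assumes C_nonneg: "0 \<le> C" and sz_nonneg: "\<And>e. 0 \<le> sz e"
    and w_nonneg: "\<And>k e. 0 \<le> w k e" and w_le: "\<And>k e. w k e \<le> W"
begin

definition feasible :: "nat set \<Rightarrow> bool" where
  "feasible X \<longleftrightarrow> X \<subseteq> {..<m} \<and> sum sz X \<le> C"

abbreviation gain :: "nat \<Rightarrow> nat set \<Rightarrow> int" where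
  "gain k X \<equiv> sum (w k) X"

definition worth :: "(nat \<Rightarrow> int) \<Rightarrow> nat \<Rightarrow> int" where
  "worth y e = (\<Sum>k<n. y k * w k e)"

definition choice :: "(nat \<Rightarrow> int) \<Rightarrow> nat set" where
  "choice y = best_set C sz (worth y) m"

text \<open>The weighted average of the best gain, rounded down to stay in the integers; the floor
  costs less than 1 per round.\<close>

definition target :: "(nat \<Rightarrow> int) \<Rightarrow> int" where
  "target y = max_value C sz (worth y) m div (\<Sum>k<n. y k)"

text \<open>Truncation at 1 rather than 0 keeps the sum of the deficits positive whenever there is
  an objective, so that division by it in \<open>target\<close> is meaningful.\<close>

primrec deficit :: "nat \<Rightarrow> nat \<Rightarrow> int" where
  "deficit 0 = (\<lambda>_. 1)"
| "deficit (Suc t) =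
     (\<lambda>k. max 1 (deficit t k + target (deficit t) - gain k (choice (deficit t))))"

definition H :: int where
  "H = int m * W"

lemma W_nonneg: "0 \<le> W"
  using w_nonneg w_le order_trans by blast

lemma H_nonneg: "0 \<le> H"
  using W_nonneg by (simp add: H_def)

lemma gain_bounds:
  assumes "X \<subseteq> {..<m}"
  shows "0 \<le> gain k X" "gain k X \<le> H"
proof -
  show "0 \<le> gain k X" using w_nonneg by (rule sum_nonneg)
  have "gain k X \<le> of_nat (card X) * W" using w_le by (intro sum_bounded_above)
  also have "\<dots> \<le> H"
    unfolding H_def using W_nonneg card_mono[OF _ assms] by (intro mult_right_mono) auto
  finally show "gain k X \<le> H" .
qed

lemma worth_nonneg: "(\<And>k. 0 \<le> y k) \<Longrightarrow> 0 \<le> worth y e"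
  unfolding worth_def using w_nonneg by (intro sum_nonneg mult_nonneg_nonneg)

lemma knapsack_worth: "(\<And>k. 0 \<le> y k) \<Longrightarrow> knapsack C sz (worth y)"
  by unfold_locales (auto simp: C_nonneg sz_nonneg worth_nonneg)

lemma sum_worth: "sum (worth y) X = (\<Sum>k<n. y k * gain k X)"
  unfolding worth_def by (subst sum.swap) (simp add: sum_distrib_left)

lemma choice_feasible: "(\<And>k. 0 \<le> y k) \<Longrightarrow> feasible (choice y)"
  using knapsack.best_set_feasible[OF knapsack_worth, of y] by (simp add: feasible_def choice_def)

lemma max_value_le_choice:
  "(\<And>k. 0 \<le> y k) \<Longrightarrow> max_value C sz (worth y) m \<le> (\<Sum>k<n. y k * gain k (choice y))"
  using knapsack.best_set_value[OF knapsack_worth, of y m] by (simp add: choice_def sum_worth)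

lemma max_value_ge_feasible:
  "(\<And>k. 0 \<le> y k) \<Longrightarrow> feasible X \<Longrightarrow> (\<Sum>k<n. y k * gain k X) \<le> max_value C sz (worth y) m"
  using knapsack.max_value_greatest[OF knapsack_worth, of y X m] by (simp add: feasible_def sum_worth)

lemma target_bounds:
  assumes "\<And>k. 0 \<le> y k"
  shows "0 \<le> target y" "target y \<le> H"
proof -
  have Y: "0 \<le> (\<Sum>k<n. y k)" using assms by (intro sum_nonneg)
  have b: "0 \<le> max_value C sz (worth y) m" by (intro max_value_bounds worth_nonneg assms)
  show "0 \<le> target y" unfolding target_def using Y b
    by (cases "(\<Sum>k<n. y k) = 0") (auto simp: pos_imp_zdiv_nonneg_iff less_le)
  have "max_value C sz (worth y) m \<le> (\<Sum>k<n. y k * H)"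
    by (rule order_trans[OF max_value_le_choice[OF assms]])
      (use choice_feasible[OF assms] in \<open>intro sum_mono mult_left_mono gain_bounds assms;
        simp add: feasible_def\<close>)
  then have le: "max_value C sz (worth y) m \<le> (\<Sum>k<n. y k) * H" by (simp add: sum_distrib_right)
  show "target y \<le> H"
  proof (cases "(\<Sum>k<n. y k) = 0")
    case True
    then show ?thesis using H_nonneg by (simp add: target_def)
  next
    case False
    with Y have "0 < (\<Sum>k<n. y k)" by simp
    then show ?thesis unfolding target_def using zdiv_mono1[OF le, of "\<Sum>k<n. y k"] by simp
  qed
qed

lemma deficit_pos: "1 \<le> deficit t k"
  by (cases t) auto

lemma deficit_nonneg: "0 \<le> deficit t k"
  using deficit_pos[of t k] by linarith

lemma deficit_le: "deficit t k \<le> 1 + int t * H"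
proof (induction t)
  case (Suc t)
  have "0 \<le> gain k (choice (deficit t))"
    using choice_feasible[OF deficit_nonneg] by (intro gain_bounds) (simp add: feasible_def)
  with Suc target_bounds(2)[of "deficit t"] deficit_nonneg[of t] H_nonneg show ?case
    by (auto simp: algebra_simps max_def)
qed simp

text \<open>Truncation only raises a deficit, so it dominates the accumulated shortfall of its
  objective.\<close>

lemma deficit_ge:
  "1 + (\<Sum>i<t. target (deficit i) - gain k (choice (deficit i))) \<le> deficit t k"
  by (induction t) auto

text \<open>The chosen set has weighted gain at least the target, so the first-order change of the
  potential is nonpositive.\<close>
lemma potential: "(\<Sum>k<n. (deficit t k)\<^sup>2) \<le> int n + int t * (int n * (H\<^sup>2 + 1))"
proof (induction t)
  case (Suc t)
  let ?y = "deficit t"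
  let ?a = "\<lambda>k. target ?y - gain k (choice ?y)"
  have a: "(?a k)\<^sup>2 \<le> H\<^sup>2" for k
  proof (rule abs_le_square_iff[THEN iffD1])
    have "choice ?y \<subseteq> {..<m}" using choice_feasible[OF deficit_nonneg] by (simp add: feasible_def)
    from gain_bounds[OF this, of k] target_bounds[of "deficit t", OF deficit_nonneg]
    show "\<bar>?a k\<bar> \<le> \<bar>H\<bar>" by auto
  qed
  have first: "(\<Sum>k<n. ?y k * ?a k) \<le> 0"
  proof -
    let ?Y = "\<Sum>k<n. ?y k"
    have "0 \<le> ?Y" by (intro sum_nonneg deficit_nonneg)
    have "?Y * target ?y \<le> max_value C sz (worth ?y) m"
    proof (cases "?Y = 0")
      case True
      then show ?thesis using max_value_bounds(1)[OF worth_nonneg[OF deficit_nonneg]] by simp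
    next
      case False
      with \<open>0 \<le> ?Y\<close> have "0 < ?Y" by simp
      \<comment> \<open>Rounding the target down is the safe direction: the total demand
        \<open>?Y * target ?y\<close> never exceeds the achievable maximum.\<close>
      then have "?Y * (max_value C sz (worth ?y) m div ?Y) \<le> max_value C sz (worth ?y) m"
        using mult_div_mod_eq[of ?Y "max_value C sz (worth ?y) m"] pos_mod_sign[of ?Y "max_value C sz (worth ?y) m"]
        by linarith
      then show ?thesis by (simp add: target_def)
    qed
    also have "\<dots> \<le> (\<Sum>k<n. ?y k * gain k (choice ?y))"
      by (rule max_value_le_choice) (rule deficit_nonneg)
    finally show ?thesis
      by (simp add: right_diff_distrib sum_subtractf sum_distrib_right)
  qed
  have "(deficit (Suc t) k)\<^sup>2 \<le> (?y k)\<^sup>2 + 2 * (?y k * ?a k) + (H\<^sup>2 + 1)" for k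
  proof -
    \<comment> \<open>The truncation adds at most 1 to the square, hence \<open>+ 1\<close> in the
      bound on the increase.\<close>
    have "(max 1 (?y k + ?a k))\<^sup>2 \<le> (?y k + ?a k)\<^sup>2 + 1" by (auto simp: max_def)
    also have "\<dots> = (?y k)\<^sup>2 + 2 * (?y k * ?a k) + (?a k)\<^sup>2 + 1" by (simp add: power2_sum)
    finally show ?thesis using a[of k] by (simp add: algebra_simps)
  qed
  then have "(\<Sum>k<n. (deficit (Suc t) k)\<^sup>2) \<le> (\<Sum>k<n. (?y k)\<^sup>2 + 2 * (?y k * ?a k) + (H\<^sup>2 + 1))"
    by (intro sum_mono)
  also have "\<dots> = (\<Sum>k<n. (?y k)\<^sup>2) + 2 * (\<Sum>k<n. ?y k * ?a k) + int n * (H\<^sup>2 + 1)"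
    unfolding sum.distrib sum_distrib_left[symmetric] by (simp add: distrib_left)
  finally show ?case using Suc first by (simp add: algebra_simps)
qed simp

text \<open>Chosen for the potential bound: with \<open>T\<close> rounds it is at most
  \<open>T * (n * (H * H + 2))\<close>, which equals \<open>T * (T - 1)\<close> and so lies below
  the square of \<open>T\<close>. Then no deficit exceeds \<open>T\<close>. The final
  \<open>+ 1\<close> also keeps \<open>T\<close> positive for \<open>n = 0\<close>.\<close>

definition rounds :: nat where
  "rounds = nat (int n * (H * H + 2) + 1)"

lemma int_rounds: "int rounds = int n * (H * H + 2) + 1"
  by (simp add: rounds_def)

lemma final_deficit_le:
  assumes "k < n"
  shows "deficit rounds k \<le> int rounds"
proof -
  have "(deficit rounds k)\<^sup>2 \<le> (\<Sum>k<n. (deficit rounds k)\<^sup>2)"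
    by (rule member_le_sum) (use assms in auto)
  also have "\<dots> \<le> int n + int rounds * (int n * (H\<^sup>2 + 1))" by (rule potential)
  also have "\<dots> \<le> int rounds * int n + int rounds * (int n * (H\<^sup>2 + 1))"
    using mult_right_mono[of 1 "int rounds" "int n"] int_rounds by simp
  also have "\<dots> = int rounds * (int rounds - 1)"
    by (simp add: int_rounds power2_eq_square algebra_simps)
  also have "\<dots> \<le> (int rounds)\<^sup>2" by (simp add: power2_eq_square algebra_simps)
  finally show ?thesis using deficit_nonneg[of rounds k] by (simp add: power2_le_iff_abs_le)
qed

text \<open>The hypothesis on \<open>l\<close> is the dual form of a lower bound on the value of the
  game; applied to the current deficits it bounds each target from below. Of the loss of 2 per
  round, one unit is the floor in \<open>target\<close> and one the final deficit, spread over the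
  rounds.\<close>

theorem total_gain_ge:
  fixes l :: real
  assumes k: "k < n"
    and l: "\<And>y V. (\<And>k. 1 \<le> y k) \<Longrightarrow> (\<And>X. feasible X \<Longrightarrow> (\<Sum>k<n. y k * gain k X) \<le> V) \<Longrightarrow>
      l * real_of_int (\<Sum>k<n. y k) \<le> real_of_int V"
  shows "real rounds * (l - 2) \<le> real_of_int (\<Sum>i<rounds. gain k (choice (deficit i)))"
proof -
  have t: "l - 1 \<le> real_of_int (target (deficit i))" for i
  proof -
    let ?Y = "\<Sum>k<n. deficit i k" and ?b = "max_value C sz (worth (deficit i)) m"
    have "int n \<le> ?Y" using sum_bounded_below[of "{..<n}" 1 "deficit i"] deficit_pos by simp
    with k have Y: "0 < ?Y" by simp
    have "l * ?Y \<le> ?b"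
      by (intro l deficit_pos max_value_ge_feasible deficit_nonneg)
    then have "l \<le> real_of_int ?b / ?Y" using Y by (simp add: pos_le_divide_eq del: of_int_sum)
    then have "l - 1 \<le> real_of_int \<lfloor>real_of_int ?b / ?Y\<rfloor>" by linarith
    then show ?thesis unfolding target_def by (simp only: floor_divide_of_int_eq)
  qed
  have "(\<Sum>i<rounds. target (deficit i)) - (\<Sum>i<rounds. gain k (choice (deficit i))) \<le> int rounds"
    using deficit_ge[where t = rounds and k = k] final_deficit_le[OF k] by (simp add: sum_subtractf)
  then have "real_of_int (\<Sum>i<rounds. target (deficit i)) - real rounds
      \<le> real_of_int (\<Sum>i<rounds. gain k (choice (deficit i)))"
    by linarith
  moreover have "real rounds * (l - 1) \<le> real_of_int (\<Sum>i<rounds. target (deficit i))"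
    using sum_bounded_below[of "{..<rounds}" "l - 1" "\<lambda>i. real_of_int (target (deficit i))"] t by simp
  ultimately show ?thesis by (simp add: algebra_simps)
qed

end

section \<open>Scaling the weights\<close>

text \<open>\<open>X 0\<close> is the capacity, followed by the \<open>m\<close> item sizes and the weights, row by row.\<close>
locale integer_instance =
  fixes n m prec :: nat and X :: "nat \<Rightarrow> int"
  assumes X_nonneg: "\<And>i. 0 \<le> X i"
begin

abbreviation cap :: int where
  "cap \<equiv> X 0"

abbreviation size :: "nat \<Rightarrow> int" where
  "size e \<equiv> X (Suc e)"

abbreviation wt :: "nat \<Rightarrow> nat \<Rightarrow> int" where
  "wt k e \<equiv> X (Suc (m + (k * m + e)))"

primrec best_single :: "nat \<Rightarrow> nat \<Rightarrow> int" where
  "best_single k 0 = 0"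
| "best_single k (Suc e) =
     (if size e \<le> cap \<and> best_single k e < wt k e then wt k e else best_single k e)"

text \<open>The guard \<open>0 < k\<close> lets the first objective initialise the minimum, since
  the initial 0 would otherwise never be exceeded.\<close>

primrec least_best :: "nat \<Rightarrow> int" where
  "least_best 0 = 0"
| "least_best (Suc k) =
     (if 0 < k \<and> least_best k \<le> best_single k m then least_best k else best_single k m)"

definition mu :: int where
  "mu = least_best n"

definition G :: int where
  "G = 4 * int prec * (int n * int m)"

text \<open>The weight in units of \<open>mu / G\<close>, rounded down and capped. For
  \<open>mu = 0\<close> the quotient is 0, which is harmless: then some objective gains nothing from
  any feasible set.\<close>

definition reduced :: "nat \<Rightarrow> int" where
  "reduced i = (let x = X (Suc (m + i)) * G div mu in if G * G < x then G * G else x)"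

lemma best_single_ge: "e < l \<Longrightarrow> size e \<le> cap \<Longrightarrow> wt k e \<le> best_single k l"
  by (induction l) (auto simp: less_Suc_eq)

lemma best_single_attained:
  "best_single k l = 0 \<or> (\<exists>e<l. size e \<le> cap \<and> wt k e = best_single k l)"
  by (induction l) (auto simp: less_Suc_eq)

lemma best_single_nonneg: "0 \<le> best_single k l"
  using best_single_attained[of k l] X_nonneg by (metis order_refl)

lemma least_best_le: "k < l \<Longrightarrow> least_best l \<le> best_single k m"
  by (induction l) (auto simp: less_Suc_eq)

lemma least_best_attained: "0 < l \<Longrightarrow> \<exists>k<l. least_best l = best_single k m"
proof (induction l)
  case (Suc l)
  then show ?case by (cases l) (auto simp: less_Suc_eq)
qed simp

lemma least_best_nonneg: "0 \<le> least_best l"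
  using best_single_nonneg by (induction l) auto

lemma mu_nonneg: "0 \<le> mu"
  by (simp add: mu_def least_best_nonneg)

lemma G_nonneg: "0 \<le> G"
  by (simp add: G_def)

lemma reduced_nonneg: "0 \<le> reduced i"
  using X_nonneg mu_nonneg G_nonneg
  by (cases "mu = 0") (auto simp: reduced_def Let_def pos_imp_zdiv_nonneg_iff less_le)

lemma reduced_le: "reduced i \<le> G * G"
  by (simp add: reduced_def Let_def)

sublocale game n m cap size "\<lambda>k e. reduced (k * m + e)" "G * G"
  by unfold_locales (auto simp: X_nonneg reduced_nonneg reduced_le)

text \<open>Measured in the unreduced integer weights: the choices stem from the reduced game, but
  their quality is judged in the given one.\<close>

definition average :: "nat \<Rightarrow> real" where
  "average k = (\<Sum>i<rounds. real_of_int (sum (wt k) (choice (deficit i)))) / real rounds"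

lemma rounds_pos: "0 < rounds"
proof -
  have "0 \<le> int n * (H * H + 2)" by simp
  with int_rounds show ?thesis by linarith
qed

lemma average_nonneg: "0 \<le> average k"
  unfolding average_def by (intro divide_nonneg_nonneg sum_nonneg) (auto intro!: sum_nonneg X_nonneg)

lemma feasible_size: "feasible S \<Longrightarrow> e \<in> S \<Longrightarrow> e < m \<and> size e \<le> cap"
  using member_le_sum[of e S size] X_nonneg finite_subset[of S "{..<m}"]
  unfolding feasible_def by force

text \<open>Compares the computed average with an arbitrary distribution \<open>p\<close> of value
  at least \<open>l\<close>. Two lower bounds on the average are combined: one relative to
  \<open>l\<close> with an additive error, and one absolute, from singletons, that dominates this
  error.\<close>

lemma average_optimal:
  fixes p :: "nat set \<Rightarrow> real" and l :: real
  assumes p: "\<And>S. 0 \<le> p S" "(\<Sum>S | feasible S. p S) = 1"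
    and l: "\<And>k. k < n \<Longrightarrow> l \<le> (\<Sum>S | feasible S. p S * real_of_int (sum (wt k) S))"
    and prec: "1 \<le> prec" and k: "k < n"
  shows "(1 - 1 / real prec) * l \<le> average k"
proof (cases "0 < l")
  case False
  then have "(1 - 1 / real prec) * l \<le> 0" using prec by (intro mult_nonneg_nonpos) auto
  then show ?thesis using average_nonneg[of k] by linarith
next
  case True
  let ?F = "Collect feasible"
  let ?r = "\<lambda>k e. real_of_int (reduced (k * m + e))"
  have gain_le: "(\<Sum>e\<in>S. real_of_int (wt k e)) \<le> real m * real_of_int (best_single k m)"
    if "feasible S" for k S
  proof -
    have "(\<Sum>e\<in>S. real_of_int (wt k e)) \<le> of_nat (card S) * real_of_int (best_single k m)"
      using feasible_size[OF that] best_single_ge by (intro sum_bounded_above) auto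
    also have "card S \<le> m" using that card_mono[of "{..<m}" S] by (auto simp: feasible_def)
    then have "of_nat (card S) * real_of_int (best_single k m) \<le> real m * real_of_int (best_single k m)"
      by (intro mult_right_mono) (auto simp: best_single_nonneg)
    finally show ?thesis .
  qed
  obtain k0 where k0: "k0 < n" "mu = best_single k0 m"
    using least_best_attained[of n] k unfolding mu_def by auto
  have l_le: "l \<le> real m * real_of_int mu"
  proof -
    have "l \<le> (\<Sum>S\<in>?F. p S * real_of_int (sum (wt k0) S))" using l[OF k0(1)] by simp
    also have "\<dots> \<le> (\<Sum>S\<in>?F. p S * (real m * real_of_int mu))"
      using gain_le p(1) k0(2) by (intro sum_mono mult_left_mono) auto
    also have "\<dots> = real m * real_of_int mu"
      using p(2) by (simp add: sum_distrib_right[symmetric])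
    finally show ?thesis .
  qed
  with True have "0 < real m * real_of_int mu" by linarith
  then have m: "0 < m" and mu: "0 < mu" using mu_nonneg by (auto simp: zero_less_mult_iff)
  \<comment> \<open>\<open>d\<close> is the rounding unit and \<open>G = K * n * m\<close>. One
    reduced weight unit thus corresponds to a tiny part of \<open>mu\<close>.\<close>
  define K where "K = 4 * real prec"
  define d where "d = real_of_int mu / real_of_int G"
  have K: "4 \<le> K" using prec by (simp add: K_def)
  have n: "0 < n" using k by simp
  have G: "real_of_int G = K * real n * real m" by (simp add: G_def K_def)
  have "0 < real_of_int G" unfolding G using K n m by simp
  then have G_pos: "1 \<le> G" by simp
  have d: "0 < d" using mu G_pos by (simp add: d_def)
  have md: "real_of_int mu / d = real_of_int G" using mu G_pos by (simp add: d_def)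
  have scaled: "real_of_int (wt k e * G div mu) \<le> real_of_int (wt k e) / d"
    "real_of_int (wt k e) / d - 1 \<le> real_of_int (wt k e * G div mu)" for k e
  proof -
    have "real_of_int (wt k e) / d = real_of_int (wt k e * G) / real_of_int mu" by (simp add: d_def)
    then have "wt k e * G div mu = \<lfloor>real_of_int (wt k e) / d\<rfloor>" by (simp only: floor_divide_of_int_eq)
    then show "real_of_int (wt k e * G div mu) \<le> real_of_int (wt k e) / d"
      "real_of_int (wt k e) / d - 1 \<le> real_of_int (wt k e * G div mu)" by linarith+
  qed
  have r_le: "d * ?r k e \<le> real_of_int (wt k e)" for k e
  proof -
    have "?r k e \<le> real_of_int (wt k e * G div mu)"
      by (simp add: reduced_def Let_def del: of_int_mult)
    with scaled(1)[of k e] have "?r k e \<le> real_of_int (wt k e) / d" by linarith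
    then show ?thesis using d by (simp add: pos_le_divide_eq mult.commute)
  qed
  \<comment> \<open>Transfers the guarantee of the dynamics to the given weights. Rounding down
    never overestimates a gain, so a lower bound in the reduced game survives multiplication by
    \<open>d\<close>.\<close>
  have average_ge: "d * (l' - 2) \<le> average k"
    if "\<And>y V. (\<And>k. 1 \<le> y k) \<Longrightarrow> (\<And>S. feasible S \<Longrightarrow> (\<Sum>k<n. y k * gain k S) \<le> V) \<Longrightarrow>
      l' * real_of_int (\<Sum>k<n. y k) \<le> real_of_int V" for l' :: real
  proof -
    have "real rounds * (l' - 2) \<le> real_of_int (\<Sum>i<rounds. gain k (choice (deficit i)))"
      by (rule total_gain_ge[OF k that]) auto
    then have "d * (real rounds * (l' - 2)) \<le> d * real_of_int (\<Sum>i<rounds. gain k (choice (deficit i)))"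
      using d by simp
    also have "\<dots> = (\<Sum>i<rounds. \<Sum>e\<in>choice (deficit i). d * ?r k e)"
      by (simp add: sum_distrib_left)
    also have "\<dots> \<le> (\<Sum>i<rounds. \<Sum>e\<in>choice (deficit i). real_of_int (wt k e))"
      by (intro sum_mono r_le)
    also have "\<dots> = real rounds * average k"
      using rounds_pos by (simp add: average_def)
    finally have "real rounds * (d * (l' - 2)) \<le> real rounds * average k" by (simp add: mult.left_commute)
    then show ?thesis using rounds_pos by simp
  qed
  have "\<exists>e<m. size e \<le> cap \<and> wt k e = best_single k m" if "k < n" for k
    using best_single_attained[of k m] least_best_le[OF that] mu unfolding mu_def by force
  then obtain single where single: "\<And>k. k < n \<Longrightarrow> single k < m" "\<And>k. k < n \<Longrightarrow> size (single k) \<le> cap"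
    "\<And>k. k < n \<Longrightarrow> wt k (single k) = best_single k m"
    by metis
  have single_feasible: "feasible {single k}" if "k < n" for k
    using single[OF that] by (simp add: feasible_def)
  \<comment> \<open>This is \<open>n\<close> times the uniform mixture of the best singletons: each
    singleton alone stays below \<open>V\<close>, even when only its own objective is
    counted.\<close>
  have single_bound: "(\<Sum>k<n. real_of_int (y k) * ?r k (single k)) \<le> real n * real_of_int V"
    if y: "\<And>k. 1 \<le> y k" and V: "\<And>S. feasible S \<Longrightarrow> (\<Sum>k<n. y k * gain k S) \<le> V" for y V
  proof -
    have "y j * reduced (j * m + single j) \<le> V" if j: "j < n" for j
    proof -
      have "y j * reduced (j * m + single j) \<le> (\<Sum>k<n. y k * reduced (k * m + single j))"
        using j y reduced_nonneg
        by (intro member_le_sum[of j "{..<n}" "\<lambda>k. y k * reduced (k * m + single j)"] mult_nonneg_nonneg)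
          (auto intro: order_trans[OF zero_le_one])
      also have "\<dots> \<le> V" using V[OF single_feasible[OF j]] by simp
      finally show ?thesis .
    qed
    then have "(\<Sum>k<n. y k * reduced (k * m + single k)) \<le> (\<Sum>k<n. V)" by (intro sum_mono) auto
    then have "real_of_int (\<Sum>k<n. y k * reduced (k * m + single k)) \<le> real_of_int (\<Sum>k<n. V)"
      by (simp only: of_int_le_iff)
    then show ?thesis by simp
  qed
  have single_ge: "real_of_int G \<le> ?r k (single k)" if "k < n" for k
  proof -
    have "mu * G \<le> wt k (single k) * G"
      using least_best_le[OF that] single(3)[OF that] G_nonneg by (intro mult_right_mono) (auto simp: mu_def)
    from zdiv_mono1[OF this mu] have "G \<le> wt k (single k) * G div mu" using mu by simp
    moreover have "G \<le> G * G" using mult_right_mono[OF G_pos G_nonneg] by simp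
    ultimately show ?thesis by (simp add: reduced_def Let_def del: of_int_mult)
  qed
  \<comment> \<open>In given units \<open>d * m * K\<close> equals \<open>mu / n\<close>, the value
    of choosing a best singleton uniformly.\<close>
  have two: "d * (real m * K - 2) \<le> average k"
  proof (rule average_ge)
    fix y V
    assume y: "\<And>k. 1 \<le> y k" and V: "\<And>S. feasible S \<Longrightarrow> (\<Sum>k<n. y k * gain k S) \<le> V"
    have "(\<Sum>k<n. real_of_int (y k) * real_of_int G) \<le> (\<Sum>k<n. real_of_int (y k) * ?r k (single k))"
      using y single_ge by (intro sum_mono mult_left_mono) (auto intro: order_trans[OF zero_le_one])
    also have "\<dots> \<le> real n * real_of_int V" by (rule single_bound[OF y V])
    finally have "real n * (real m * K * real_of_int (\<Sum>k<n. y k)) \<le> real n * real_of_int V"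
      unfolding sum_distrib_right[symmetric] by (simp add: G mult_ac)
    then show "real m * K * real_of_int (\<Sum>k<n. y k) \<le> real_of_int V" using n by simp
  qed
  \<comment> \<open>The value, in reduced units, credited to playing \<open>p\<close> with
    probability \<open>1 - 1 / K\<close> and a uniform best singleton with probability
    \<open>1 / K\<close>; the term \<open>m\<close> covers rounding, at most 1 per item.\<close>
  define l1 where "l1 = (1 - 1 / K) * (l / d) - real m"
  let ?E = "\<lambda>k. \<Sum>S\<in>?F. p S * (\<Sum>e\<in>S. ?r k e)"
  have E_nonneg: "0 \<le> ?E k" for k
    using p(1) reduced_nonneg by (intro sum_nonneg mult_nonneg_nonneg) auto
  have K1: "0 \<le> 1 - 1 / K" "1 - 1 / K \<le> 1" using K by auto
  \<comment> \<open>Case distinction per objective: if the cap strikes some fitting item, the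
    singleton part suffices alone; otherwise only rounding separates \<open>p\<close> from its
    reduced value.\<close>
  have bracket: "l1 \<le> (1 - 1 / K) * ?E k + ?r k (single k) / (real n * K)" if k: "k < n" for k
  proof (cases "\<exists>e<m. size e \<le> cap \<and> G * G < wt k e * G div mu")
    case True
    then obtain e where e: "e < m" "size e \<le> cap" "G * G < wt k e * G div mu" by auto
    have "wt k e * G \<le> wt k (single k) * G"
      using best_single_ge[OF e(1,2), of k] single(3)[OF k] G_nonneg by (intro mult_right_mono) auto
    from zdiv_mono1[OF this mu] e(3) have "reduced (k * m + single k) = G * G"
      by (simp add: reduced_def Let_def)
    \<comment> \<open>This explains the cap \<open>G * G\<close>: its share in the mixture is
      exactly \<open>m * G\<close>, which is an upper bound on \<open>l / d\<close>.\<close>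
    then have "?r k (single k) / (real n * K) = real_of_int G * real m"
      using n K by (simp add: G)
    moreover have "l / d \<le> real_of_int G * real m"
    proof -
      have "l / d \<le> real m * real_of_int mu / d" using l_le d by (intro divide_right_mono) auto
      also have "\<dots> = real m * (real_of_int mu / d)" by simp
      finally show ?thesis unfolding md by (simp add: mult.commute)
    qed
    moreover have "(1 - 1 / K) * (l / d) \<le> l / d"
      using K1 \<open>0 < l\<close> d by (intro mult_left_le_one_le) auto
    moreover have "0 \<le> (1 - 1 / K) * ?E k" using K1 E_nonneg by (intro mult_nonneg_nonneg)
    ultimately show ?thesis unfolding l1_def using m by simp
  next
    case False
    have r_ge: "real_of_int (wt k e) / d - 1 \<le> ?r k e" if "e < m" "size e \<le> cap" for e
    proof -
      have "reduced (k * m + e) = wt k e * G div mu"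
        using False that by (auto simp: reduced_def Let_def)
      then show ?thesis using scaled(2)[of k e] by simp
    qed
    have "(\<Sum>e\<in>S. real_of_int (wt k e)) / d - real m \<le> (\<Sum>e\<in>S. ?r k e)" if S: "feasible S" for S
    proof -
      have "card S \<le> m" using S card_mono[of "{..<m}" S] by (auto simp: feasible_def)
      then have "(\<Sum>e\<in>S. real_of_int (wt k e)) / d - real m
          \<le> (\<Sum>e\<in>S. real_of_int (wt k e) / d - 1)"
        by (simp add: sum_subtractf sum_divide_distrib)
      also have "\<dots> \<le> (\<Sum>e\<in>S. ?r k e)"
        using feasible_size[OF S] r_ge by (intro sum_mono) auto
      finally show ?thesis .
    qed
    then have "(\<Sum>S\<in>?F. p S * ((\<Sum>e\<in>S. real_of_int (wt k e)) / d - real m)) \<le> ?E k"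
      using p(1) by (intro sum_mono mult_left_mono) auto
    moreover have "(\<Sum>S\<in>?F. p S * ((\<Sum>e\<in>S. real_of_int (wt k e)) / d - real m))
        = (\<Sum>S\<in>?F. p S * real_of_int (sum (wt k) S)) / d - real m"
      unfolding right_diff_distrib sum_subtractf times_divide_eq_right sum_divide_distrib[symmetric]
        sum_distrib_right[symmetric] p(2) by simp
    moreover have "l / d \<le> (\<Sum>S\<in>?F. p S * real_of_int (sum (wt k) S)) / d"
      using l[OF k] d by (intro divide_right_mono) auto
    ultimately have "l / d - real m \<le> ?E k" by linarith
    then have "(1 - 1 / K) * (l / d - real m) \<le> (1 - 1 / K) * ?E k"
      using K1 by (intro mult_left_mono)
    moreover have "l1 \<le> (1 - 1 / K) * (l / d - real m)"
      unfolding l1_def right_diff_distrib using mult_left_le_one_le[OF _ K1, of "real m"] by simp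
    moreover have "0 \<le> ?r k (single k) / (real n * K)" using K reduced_nonneg by simp
    ultimately show ?thesis by linarith
  qed
  have one: "d * (l1 - 2) \<le> average k"
  proof (rule average_ge)
    fix y V
    assume y: "\<And>k. 1 \<le> y k" and V: "\<And>S. feasible S \<Longrightarrow> (\<Sum>k<n. y k * gain k S) \<le> V"
    have y0: "0 \<le> real_of_int (y k)" for k using y[of k] by simp
    \<comment> \<open>Weak duality: exchanging the sums exhibits the weighted gain of
      \<open>p\<close> as an average over feasible sets, each bounded by \<open>V\<close>.\<close>
    have "(\<Sum>k<n. real_of_int (y k) * ?E k) = (\<Sum>S\<in>?F. p S * (\<Sum>k<n. real_of_int (y k) * (\<Sum>e\<in>S. ?r k e)))"
      by (simp add: sum_distrib_left sum.swap[of _ ?F] mult.left_commute)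
    also have "\<dots> \<le> (\<Sum>S\<in>?F. p S * real_of_int V)"
    proof (intro sum_mono mult_left_mono p)
      fix S assume "S \<in> ?F"
      then have "real_of_int (\<Sum>k<n. y k * gain k S) \<le> real_of_int V"
        unfolding of_int_le_iff by (intro V) simp
      then show "(\<Sum>k<n. real_of_int (y k) * (\<Sum>e\<in>S. ?r k e)) \<le> real_of_int V" by simp
    qed
    also have "\<dots> = real_of_int V" using p(2) by (simp add: sum_distrib_right[symmetric])
    finally have 1: "(1 - 1 / K) * (\<Sum>k<n. real_of_int (y k) * ?E k) \<le> (1 - 1 / K) * real_of_int V"
      using K1 by (intro mult_left_mono)
    have "(\<Sum>k<n. real_of_int (y k) * ?r k (single k)) / (real n * K) \<le> real n * real_of_int V / (real n * K)"
      using K by (intro divide_right_mono single_bound[OF y V]) auto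
    then have 2: "(\<Sum>k<n. real_of_int (y k) * ?r k (single k)) / (real n * K) \<le> real_of_int V / K"
      using n by simp
    have "l1 * real_of_int (\<Sum>k<n. y k) = (\<Sum>k<n. real_of_int (y k) * l1)"
      unfolding sum_distrib_right[symmetric] by simp
    also have "\<dots> \<le> (\<Sum>k<n. real_of_int (y k) * ((1 - 1 / K) * ?E k + ?r k (single k) / (real n * K)))"
      using bracket y0 by (intro sum_mono mult_left_mono) auto
    also have "\<dots> = (1 - 1 / K) * (\<Sum>k<n. real_of_int (y k) * ?E k)
        + (\<Sum>k<n. real_of_int (y k) * ?r k (single k)) / (real n * K)"
      unfolding distrib_left sum.distrib sum_divide_distrib
      by (simp add: sum_distrib_left mult.left_commute)
    also have "\<dots> \<le> (1 - 1 / K) * real_of_int V + real_of_int V / K" using 1 2 by linarith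
    also have "\<dots> = real_of_int V" by (simp add: left_diff_distrib)
    finally show "l1 * real_of_int (\<Sum>k<n. y k) \<le> real_of_int V" .
  qed
  text \<open>The second bound makes the additive error of the first one relative.\<close>
  have "d * (l1 - 2) = (1 - 1 / K) * l - d * (real m + 2)"
    using d by (simp add: l1_def algebra_simps)
  with one have 3: "(1 - 1 / K) * l - d * (real m + 2) \<le> average k" by simp
  \<comment> \<open>The additive error \<open>d * (m + 2)\<close> is at most about
    \<open>3 / K\<close> times the singleton value, because
    \<open>m + 2 \<le> 3 * m\<close>.\<close>
  have 4: "d * (real m + 2) * (K - 2) \<le> 3 * average k"
  proof -
    have "(real m + 2) * (K - 2) \<le> (3 * real m) * (K - 2)" using m K by (intro mult_right_mono) auto
    also have "\<dots> \<le> 3 * (real m * K - 2)" using m by (simp add: algebra_simps)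
    finally have "d * ((real m + 2) * (K - 2)) \<le> d * (3 * (real m * K - 2))"
      using d by (intro mult_left_mono) auto
    then have "d * (real m + 2) * (K - 2) \<le> 3 * (d * (real m * K - 2))"
      unfolding mult.assoc mult.left_commute[of d 3] .
    then show ?thesis using two by linarith
  qed
  have "(K - 2) * ((1 - 1 / K) * l) \<le> (K + 1) * average k"
    using mult_left_mono[OF 3, of "K - 2"] K 4 by (simp add: algebra_simps)
  \<comment> \<open>Elementary inequality that turns both losses into the single factor
    \<open>1 - 4 / K\<close>, which is \<open>1 - 1 / prec\<close>.\<close>
  moreover have "(K + 1) * ((1 - 4 / K) * l) \<le> (K - 2) * ((1 - 1 / K) * l)"
  proof -
    have "(K + 1) * (1 - 4 / K) = K - 3 - 4 / K" "(K - 2) * (1 - 1 / K) = K - 3 + 2 / K"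
      using K by (simp_all add: field_simps)
    then have "(K + 1) * (1 - 4 / K) \<le> (K - 2) * (1 - 1 / K)"
      using K divide_nonneg_nonneg[of 4 K] divide_nonneg_nonneg[of 2 K] by linarith
    from mult_right_mono[OF this, of l] \<open>0 < l\<close> show ?thesis by (simp add: mult.assoc)
  qed
  ultimately have "(K + 1) * ((1 - 4 / K) * l) \<le> (K + 1) * average k" by linarith
  then have "(1 - 4 / K) * l \<le> average k" using K by simp
  then show ?thesis by (simp add: K_def)
qed

end

section \<open>The program\<close>

text \<open>The number of objectives, but \<open>0\<close> if there are no items: only the product of both numbers is
  bounded by the input size.\<close>
definition nE :: aexp where
  "nE = Quot (Times (Read ''input'' (Num 0)) (Read ''input'' (Num 1))) (Read ''input'' (Num 1))"

definition mE :: aexp where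
  "mE = Read ''input'' (Num 1)"

definition cntE :: aexp where
  "cntE = Plus (Num 1) (Plus mE (Times nE mE))"

definition GE :: aexp where
  "GE = Times (Times (Num 4) (Var ''precision'')) (Times nE mE)"

definition HE :: aexp where
  "HE = Times mE (Times GE GE)"

definition TE :: aexp where
  "TE = Plus (Times nE (Plus (Times HE HE) (Num 2))) (Num 1)"

abbreviation wtE :: aexp where
  "wtE \<equiv> Read ''x'' (Plus (Plus (Num 1) mE) (Plus (Times (Var ''k'') mE) (Var ''e'')))"

abbreviation redE :: aexp where
  "redE \<equiv> Read ''w'' (Plus (Times (Var ''k'') mE) (Var ''e''))"

text \<open>Multiplies capacity, sizes and weights by one common number, the product of all
  denominators. This preserves feasibility and the ratios of objective values.\<close>

definition scale_prog :: com where
  "scale_prog =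
     Seq (Seq (Set ''D'' (Num 1))
       (For ''i'' cntE (Set ''D''
         (Times (Var ''D'') (Read ''input'' (Plus (Num 3) (Times (Num 2) (Var ''i''))))))))
     (For ''i'' cntE (Write ''x'' (Var ''i'')
        (Quot (Times (Read ''input'' (Plus (Num 2) (Times (Num 2) (Var ''i'')))) (Var ''D''))
          (Read ''input'' (Plus (Num 3) (Times (Num 2) (Var ''i'')))))))"

definition best_single_prog :: com where
  "best_single_prog =
     Seq (Set ''M'' (Num 0))
       (For ''e'' mE (If (Conj (Neg (Less (Var ''x'') (Read ''x'' (Plus (Num 1) (Var ''e'')))))
           (Less (Var ''M'') wtE)) (Set ''M'' wtE) Skip))"

definition least_best_prog :: com where
  "least_best_prog =
     Seq (Set ''u'' (Num 0))
       (For ''k'' nE (Seq best_single_prog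
         (If (Conj (Less (Num 0) (Var ''k'')) (Neg (Less (Var ''M'') (Var ''u'')))) Skip
           (Set ''u'' (Var ''M'')))))"

definition reduce_prog :: com where
  "reduce_prog =
     For ''i'' (Times nE mE)
       (If (Less (Times GE GE)
             (Quot (Times (Read ''x'' (Plus (Plus (Num 1) mE) (Var ''i''))) GE) (Var ''u'')))
         (Write ''w'' (Var ''i'') (Times GE GE))
         (Write ''w'' (Var ''i'')
           (Quot (Times (Read ''x'' (Plus (Plus (Num 1) mE) (Var ''i''))) GE) (Var ''u''))))"

definition sum_prog :: "array \<Rightarrow> array \<Rightarrow> array \<Rightarrow> aexp \<Rightarrow> com" where
  "sum_prog S x i a = Seq (Set S (Num 0)) (For i a (Set S (Plus (Var S) (Read x (Var i)))))"

definition worth_prog :: com where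
  "worth_prog =
     For ''e'' mE (Seq (Write ''v'' (Var ''e'') (Num 0))
       (For ''k'' nE (Write ''v'' (Var ''e'')
         (Plus (Read ''v'' (Var ''e'')) (Times (Read ''y'' (Var ''k'')) redE)))))"

abbreviation colsE :: aexp where
  "colsE \<equiv> Plus (Var ''P'') (Num 1)"

text \<open>Array \<open>A\<close> holds the knapsack table row by row in rows of length
  \<open>P + 1\<close>, one column for each demanded value from 0 to \<open>P\<close>.\<close>

definition first_row_prog :: com where
  "first_row_prog =
     For ''j'' colsE (If (Less (Num 0) (Var ''j''))
       (Write ''A'' (Var ''j'') (Plus (Var ''x'') (Num 1)))
       (Write ''A'' (Var ''j'') (Num 0)))"

definition rest_prog :: "aexp \<Rightarrow> com" where
  "rest_prog a =
     If (Less a (Read ''v'' (Var ''e''))) (Set ''r'' (Num 0))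
       (Set ''r'' (Minus a (Read ''v'' (Var ''e''))))"

abbreviation takeE :: aexp where
  "takeE \<equiv> Plus (Read ''A'' (Plus (Times (Var ''e'') colsE) (Var ''r'')))
     (Read ''x'' (Plus (Num 1) (Var ''e'')))"

abbreviation skipE :: aexp where
  "skipE \<equiv> Read ''A'' (Plus (Times (Var ''e'') colsE) (Var ''j''))"

abbreviation cellE :: aexp where
  "cellE \<equiv> Plus (Times (Plus (Var ''e'') (Num 1)) colsE) (Var ''j'')"

definition row_prog :: com where
  "row_prog =
     For ''j'' colsE (Seq (rest_prog (Var ''j''))
       (If (Less takeE skipE) (Write ''A'' cellE takeE) (Write ''A'' cellE skipE)))"

definition table_prog :: com where
  "table_prog = Seq first_row_prog (For ''e'' mE row_prog)"

definition scan_prog :: com where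
  "scan_prog =
     Seq (Set ''b'' (Num 0))
       (For ''j'' colsE (If (Less (Var ''x'') (Read ''A'' (Plus (Times mE colsE) (Var ''j''))))
         Skip (Set ''b'' (Var ''j''))))"

text \<open>Loops count upwards, so the item is recovered as \<open>m - 1 - i\<close>. Zeros are
  written explicitly because \<open>z\<close> still holds the choice of the previous round.\<close>

definition backtrack_prog :: com where
  "backtrack_prog =
     Seq (Set ''r'' (Var ''b''))
       (For ''i'' mE (Seq (Set ''e'' (Minus (Minus mE (Num 1)) (Var ''i'')))
         (If (Less (Read ''A'' (Plus (Times (Plus (Var ''e'') (Num 1)) colsE) (Var ''r'')))
               (Read ''A'' (Plus (Times (Var ''e'') colsE) (Var ''r''))))
           (Seq (Write ''z'' (Var ''e'') (Num 1)) (rest_prog (Var ''r'')))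
           (Write ''z'' (Var ''e'') (Num 0)))))"

abbreviation entryE :: aexp where
  "entryE \<equiv> Plus (Num 1) (Times (Var ''t'') (Plus mE (Num 2)))"

text \<open>Every round emits one entry of probability \<open>1 / rounds\<close>; repeated sets are
  merged by the output convention.\<close>

definition output_prog :: com where
  "output_prog =
     Seq (Write ''output'' entryE (Num 1))
     (Seq (Write ''output'' (Plus entryE (Num 1)) TE)
       (For ''e'' mE (Write ''output'' (Plus (Plus entryE (Num 2)) (Var ''e''))
         (Read ''z'' (Var ''e'')))))"

abbreviation newE :: aexp where
  "newE \<equiv> Minus (Plus (Read ''y'' (Var ''k'')) (Quot (Var ''b'') (Var ''Y''))) (Var ''f'')"

definition update_prog :: com where
  "update_prog =
     For ''k'' nE (Seq (Seq (Set ''f'' (Num 0))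
         (For ''e'' mE (Set ''f'' (Plus (Var ''f'') (Times (Read ''z'' (Var ''e'')) redE)))))
       (If (Less newE (Num 1)) (Write ''y'' (Var ''k'') (Num 1)) (Write ''y'' (Var ''k'') newE)))"

text \<open>Roles of the arrays: \<open>y\<close> deficits and \<open>Y\<close> their sum,
  \<open>v\<close> weighted item values and \<open>P\<close> their sum, \<open>b\<close> the best
  weighted value, \<open>z\<close> the chosen set, \<open>f\<close> its gain for one
  objective.\<close>

definition round_prog :: com where
  "round_prog =
     Seq (sum_prog ''Y'' ''y'' ''k'' nE)
     (Seq worth_prog
     (Seq (sum_prog ''P'' ''v'' ''e'' mE)
     (Seq table_prog
     (Seq scan_prog
     (Seq backtrack_prog
     (Seq output_prog update_prog))))))"

definition fptas :: com where
  "fptas =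
     Seq scale_prog
     (Seq least_best_prog
     (Seq reduce_prog
     (Seq (For ''k'' nE (Write ''y'' (Var ''k'') (Num 1)))
     (Seq (Set ''output'' TE)
       (For ''t'' TE round_prog)))))"

lemma reads_simps [simp]:
  "reads nE = {''input''}" "reads mE = {''input''}" "reads cntE = {''input''}"
  "reads GE = {''input'', ''precision''}" "reads HE = {''input'', ''precision''}"
  "reads TE = {''input'', ''precision''}"
  by (auto simp: nE_def mE_def cntE_def GE_def HE_def TE_def)

lemma writes_simps [simp]:
  "writes scale_prog = {''D'', ''i'', ''x''}"
  "writes best_single_prog = {''M'', ''e''}"
  "writes least_best_prog = {''M'', ''e'', ''u'', ''k''}"
  "writes reduce_prog = {''w'', ''i''}"
  "writes (sum_prog S x i a) = {S, i}"
  "writes worth_prog = {''v'', ''e'', ''k''}"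
  "writes first_row_prog = {''A'', ''j''}"
  "writes (rest_prog a) = {''r''}"
  "writes row_prog = {''A'', ''j'', ''r''}"
  "writes table_prog = {''A'', ''j'', ''r'', ''e''}"
  "writes scan_prog = {''b'', ''j''}"
  "writes backtrack_prog = {''r'', ''i'', ''e'', ''z''}"
  "writes output_prog = {''output'', ''e''}"
  "writes update_prog = {''k'', ''f'', ''e'', ''y''}"
  by (auto simp: scale_prog_def best_single_prog_def least_best_prog_def reduce_prog_def
      sum_prog_def worth_prog_def first_row_prog_def rest_prog_def row_prog_def table_prog_def
      scan_prog_def backtrack_prog_def output_prog_def update_prog_def)

lemma writes_round_prog [simp]:
  "writes round_prog = {''Y'', ''k'', ''v'', ''e'', ''P'', ''A'', ''j'', ''r'', ''b'', ''i'', ''z'',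
     ''output'', ''f'', ''y''}"
  by (auto simp: round_prog_def)

text \<open>Prefix agreement suits arrays that are filled in address order: one write at the end
  extends the prefix.\<close>

definition stored :: "store \<Rightarrow> array \<Rightarrow> nat \<Rightarrow> (nat \<Rightarrow> int) \<Rightarrow> bool" where
  "stored s x N f \<longleftrightarrow> (\<forall>i<N. s x (int i) = f i)"

lemma stored_0 [simp]: "stored s x 0 f"
  by (simp add: stored_def)

lemma stored_read: "stored s x N f \<Longrightarrow> i < N \<Longrightarrow> a = int i \<Longrightarrow> s x a = f i"
  by (simp add: stored_def)

lemma stored_cong: "s x = s' x \<Longrightarrow> stored s x N f \<longleftrightarrow> stored s' x N f"
  by (simp add: stored_def)

lemma stored_upd [simp]: "x \<noteq> y \<Longrightarrow> stored (s(y := h)) x N f \<longleftrightarrow> stored s x N f"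
  by (simp add: stored_def)

lemma stored_Suc:
  "stored s x N f \<Longrightarrow> a = int N \<Longrightarrow> z = f N \<Longrightarrow> stored (s(x := (s x)(a := z))) x (Suc N) f"
  by (simp add: stored_def less_Suc_eq)

lemma flat_index_less: "k < n \<Longrightarrow> e < m \<Longrightarrow> k * m + e < n * (m::nat)"
proof -
  assume "k < n" "e < m"
  then have "k * m + e < Suc k * m" by simp
  also have "\<dots> \<le> n * m" using \<open>k < n\<close> by (intro mult_le_mono1) simp
  finally show ?thesis .
qed

section \<open>Correctness of the program\<close>

locale fptas_run = resources R B for R B +
  fixes inp pr :: "int \<Rightarrow> int" and n m prec :: nat
  assumes inp_nonneg: "\<And>i. 0 \<le> inp (int i)"
    and inp_m: "inp 1 = int m" and inp_n: "inp 0 * inp 1 div inp 1 = int n" and pr_0: "pr 0 = int prec"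
begin

definition cnt :: nat where
  "cnt = Suc (m + n * m)"

definition dens :: "nat \<Rightarrow> int" where
  "dens i = (\<Prod>j<i. inp (3 + 2 * int j))"

definition scaled :: "nat \<Rightarrow> int" where
  "scaled i = inp (2 + 2 * int i) * dens cnt div inp (3 + 2 * int i)"

lemma dens_nonneg: "0 \<le> dens i"
  unfolding dens_def
proof (intro prod_nonneg)
  fix j
  show "0 \<le> inp (3 + 2 * int j)" using inp_nonneg[of "3 + 2 * j"] by simp
qed

lemma scaled_nonneg: "0 \<le> scaled i"
proof -
  have "0 \<le> inp (2 + 2 * int i)" "0 \<le> inp (3 + 2 * int i)"
    using inp_nonneg[of "2 + 2 * i"] inp_nonneg[of "3 + 2 * i"] by simp_all
  then show ?thesis
    unfolding scaled_def using dens_nonneg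
    by (cases "inp (3 + 2 * int i) = 0") (auto simp: pos_imp_zdiv_nonneg_iff less_le)
qed

sublocale integer_instance n m prec scaled
  by unfold_locales (rule scaled_nonneg)

abbreviation ymax :: int where
  "ymax \<equiv> 1 + int rounds * H"

end

text \<open>Loop bounds and weighted values must be at most \<open>R\<close>, scaled data only at
  most \<open>B\<close>. Two inequalities are strict: the table contains \<open>cap + 1\<close>, and
  it has one column more than the largest value.\<close>

locale bounded_fptas_run = fptas_run +
  assumes dens_le: "\<And>i. i \<le> cnt \<Longrightarrow> dens i \<le> B"
    and scaled_le: "\<And>i. i < cnt \<Longrightarrow> scaled i < B"
    and cnt_le: "cnt \<le> R" and n_le: "n \<le> R" and rounds_le: "rounds \<le> R"
    and G_le: "G * G \<le> int R" and H_le: "H \<le> int R" and ymax_le: "ymax \<le> int R"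
    and ysum_le: "int n * ymax \<le> int R"
    and worth_le: "int n * (ymax * (G * G)) \<le> int R"
    and table_le: "int m * (int n * (ymax * (G * G))) < int R"
begin

lemma m_le: "m \<le> R"
  using cnt_le by (simp add: cnt_def)

lemma nm_le: "n * m \<le> R"
  using cnt_le by (simp add: cnt_def)

lemma R_pos: "1 \<le> R"
  using cnt_le by (simp add: cnt_def)

lemma aval_simps:
  assumes "s ''input'' = inp"
  shows "aval nE s = int n" "aval mE s = int m" "aval cntE s = int cnt"
proof -
  show n: "aval nE s = int n" using inp_n assms by (simp add: nE_def)
  show m: "aval mE s = int m" using inp_m assms by (simp add: mE_def)
  show "aval cntE s = int cnt" by (simp add: cntE_def n m cnt_def)
qed

lemma aval_G:
  assumes "s ''input'' = inp" "s ''precision'' = pr"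
  shows "aval GE s = G" "aval HE s = H" "aval TE s = int rounds"
proof -
  show G: "aval GE s = G" using pr_0 assms by (simp add: GE_def aval_simps G_def)
  show H: "aval HE s = H" by (simp add: HE_def aval_simps assms G H_def)
  show "aval TE s = int rounds" by (simp add: TE_def aval_simps assms H int_rounds)
qed

lemma cap_less: "scaled 0 < B"
  by (rule scaled_le) (simp add: cnt_def)

lemma abs_le_B: "0 \<le> x \<Longrightarrow> x \<le> int R \<Longrightarrow> \<bar>x\<bar> \<le> B"
  using R_le_B by simp

section \<open>Preprocessing: integral and reduced weights\<close>

lemma wp_scale:
  assumes "s ''input'' = inp"
  shows "wp scale_prog (\<lambda>s'. stored s' ''x'' cnt scaled) s"
  unfolding scale_prog_def
proof (rule wp_Seq)
  let ?c = "Seq (Set ''D'' (Num 1)) (For ''i'' cntE (Set ''D''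
      (Times (Var ''D'') (Read ''input'' (Plus (Num 3) (Times (Num 2) (Var ''i'')))))))"
  have "wp ?c (\<lambda>s'. s' ''D'' 0 = dens cnt) s"
  proof (rule wp_Seq, rule wp_Write)
    show "\<bar>aval (Num 1) s\<bar> \<le> B" using R_pos R_le_B by simp
    let ?s = "s(''D'' := (s ''D'')(aval (Num 0) s := aval (Num 1) s))"
    show "wp (For ''i'' cntE (Set ''D''
      (Times (Var ''D'') (Read ''input'' (Plus (Num 3) (Times (Num 2) (Var ''i''))))))) (\<lambda>s'. s' ''D'' 0 = dens cnt) ?s"
    proof (rule wp_For[where N = cnt and Inv = "\<lambda>i s. s ''D'' 0 = dens i"])
      fix k s' assume a: "k < cnt" "s' ''D'' 0 = dens k" "s' ''i'' 0 = int k"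
        "\<forall>y. y \<notin> insert ''i'' (writes (Set ''D'' (Times (Var ''D'') (Read ''input'' (Plus (Num 3) (Times (Num 2) (Var ''i''))))))) \<longrightarrow> s' y = ?s y"
      then have i: "s' ''input'' = inp" using assms by simp
      have d: "dens (Suc k) = dens k * inp (3 + 2 * int k)" by (simp add: dens_def)
      show "wp (Set ''D'' (Times (Var ''D'') (Read ''input'' (Plus (Num 3) (Times (Num 2) (Var ''i''))))))
          (\<lambda>s. s ''D'' 0 = dens (Suc k)) s'"
        by (rule wp_Write) (use a(1-3) i dens_le[of "Suc k"] dens_nonneg[of "Suc k"] d in auto)
    qed (use assms cnt_le in \<open>auto simp: aval_simps dens_def\<close>)
  qed
  then show "wp ?c (wp (For ''i'' cntE (Write ''x'' (Var ''i'')
        (Quot (Times (Read ''input'' (Plus (Num 2) (Times (Num 2) (Var ''i'')))) (Var ''D''))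
          (Read ''input'' (Plus (Num 3) (Times (Num 2) (Var ''i''))))))) (\<lambda>s'. stored s' ''x'' cnt scaled)) s"
  proof (rule wp_mono_frame)
    fix s' assume D: "s' ''D'' 0 = dens cnt" and "\<forall>y. y \<notin> writes ?c \<longrightarrow> s' y = s y"
    then have i: "s' ''input'' = inp" using assms by simp
    show "wp (For ''i'' cntE (Write ''x'' (Var ''i'')
        (Quot (Times (Read ''input'' (Plus (Num 2) (Times (Num 2) (Var ''i'')))) (Var ''D''))
          (Read ''input'' (Plus (Num 3) (Times (Num 2) (Var ''i''))))))) (\<lambda>s'. stored s' ''x'' cnt scaled) s'"
    proof (rule wp_For[where N = cnt and Inv = "\<lambda>i s. stored s ''x'' i scaled"], goal_cases)
      case (7 k s2)
      then have "s2 ''input'' = inp" "s2 ''D'' 0 = dens cnt" using i D by simp_all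
      with 7(1-3) scaled_le[of k] scaled_nonneg[of k] show ?case
        by (intro wp_Write stored_Suc) (auto simp: scaled_def)
    qed (use i cnt_le in \<open>auto simp: aval_simps\<close>)
  qed
qed

lemma wp_best_single:
  assumes i: "s ''input'' = inp" and x: "stored s ''x'' cnt scaled" and k: "s ''k'' 0 = int k" "k < n"
  shows "wp best_single_prog (\<lambda>s'. s' ''M'' 0 = best_single k m) s"
  unfolding best_single_prog_def
proof (rule wp_Seq, rule wp_Write, goal_cases)
  case 2
  show ?case
  proof (rule wp_For[where N = m and Inv = "\<lambda>e s. s ''M'' 0 = best_single k e"], goal_cases)
    case (7 e s')
    then have fr: "s' ''input'' = inp" "s' ''x'' = s ''x''" "s' ''k'' 0 = int k"
      using i k by (simp_all add: fun_upd_def)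
    have idx: "Suc (m + (k * m + e)) < cnt" "Suc e < cnt" "0 < cnt"
      using flat_index_less[OF k(2) 7(1)] 7(1) by (simp_all add: cnt_def)
    have x': "s ''x'' (1 + int m + (int k * int m + int e)) = wt k e"
      "s ''x'' (1 + int e) = scaled (Suc e)" "s ''x'' 0 = scaled 0"
      using stored_read[OF x idx(1)] stored_read[OF x idx(2)] stored_read[OF x idx(3)]
      by (simp_all add: algebra_simps)
    show ?case
      using 7(2,3) scaled_le[OF idx(1)] scaled_nonneg
      by (intro wp_If wp_Write wp_Skip) (auto simp: aval_simps fr x')
  qed (use i m_le B_nonneg in \<open>auto simp: aval_simps\<close>)
qed (use B_nonneg in simp)

lemma best_single_le_B: "k < n \<Longrightarrow> best_single k m \<le> B"
proof -
  assume k: "k < n"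
  show ?thesis
  proof (cases "best_single k m = 0")
    case False
    with best_single_attained[of k m] obtain e where e: "e < m" "wt k e = best_single k m" by auto
    have "Suc (m + (k * m + e)) < cnt" using flat_index_less[OF k e(1)] by (simp add: cnt_def)
    from scaled_le[OF this] e(2) show ?thesis by simp
  qed (use B_nonneg in simp)
qed

lemma wp_least_best:
  assumes i: "s ''input'' = inp" and x: "stored s ''x'' cnt scaled"
  shows "wp least_best_prog (\<lambda>s'. s' ''u'' 0 = mu) s"
  unfolding least_best_prog_def
proof (rule wp_Seq, rule wp_Write, goal_cases)
  case 2
  show ?case
  proof (rule wp_For[where N = n and Inv = "\<lambda>k s. s ''u'' 0 = least_best k"], goal_cases)
    case (7 k s')
    then have fr: "s' ''input'' = inp" "s' ''x'' = s ''x''"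
      using i by simp_all
    have single: "wp best_single_prog (\<lambda>s'. s' ''M'' 0 = best_single k m) s'"
      by (rule wp_best_single) (use 7 fr x stored_cong[of s' "''x''" s] in auto)
    show ?case
    proof (rule wp_Seq, rule wp_mono_frame[OF single], goal_cases)
      case (1 s2)
      then have "s2 ''u'' 0 = least_best k" "s2 ''k'' 0 = int k" using 7 by simp_all
      with 1(1) best_single_le_B[OF 7(1)] best_single_nonneg[of k m] show ?case
        by (intro wp_If wp_Write wp_Skip) auto
    qed
  qed (use i n_le B_nonneg in \<open>auto simp: aval_simps mu_def\<close>)
qed (use B_nonneg in simp)

lemma wp_reduce:
  assumes i: "s ''input'' = inp" "s ''precision'' = pr" and x: "stored s ''x'' cnt scaled"
    and u: "s ''u'' 0 = mu"
  shows "wp reduce_prog (\<lambda>s'. stored s' ''w'' (n * m) reduced) s"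
  unfolding reduce_prog_def
proof (rule wp_For[where N = "n * m" and Inv = "\<lambda>i s. stored s ''w'' i reduced"], goal_cases)
  case (7 k s')
  then have fr: "s' ''input'' = inp" "s' ''precision'' = pr" "s' ''x'' = s ''x''" "s' ''u'' 0 = mu"
    using i u by simp_all
  have x': "s ''x'' (1 + int m + int k) = scaled (Suc (m + k))"
    using stored_read[OF x, of "Suc (m + k)"] 7(1) by (simp add: cnt_def add.assoc)
  have red: "G * G < scaled (Suc (m + k)) * G div mu \<Longrightarrow> reduced k = G * G"
    "\<not> G * G < scaled (Suc (m + k)) * G div mu \<Longrightarrow> reduced k = scaled (Suc (m + k)) * G div mu"
    by (simp_all add: reduced_def)
  have le: "\<bar>reduced k\<bar> \<le> B" using reduced_nonneg[of k] reduced_le[of k] G_le by (intro abs_le_B) auto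
  show ?case
    using 7(2,3) le by (intro wp_If wp_Write stored_Suc) (auto simp: aval_simps aval_G fr x' red)
qed (use i nm_le in \<open>auto simp: aval_simps\<close>)

section \<open>One round: solving the weighted knapsack problem\<close>

lemma wp_sum:
  assumes x: "stored s x N f" and a: "aval a s = int N" "reads a \<inter> {S, i} = {}" "N \<le> R"
    and d: "x \<noteq> S" "x \<noteq> i" "S \<noteq> i" and le: "\<And>j. j < N \<Longrightarrow> 0 \<le> f j" "(\<Sum>j<N. f j) \<le> B"
  shows "wp (sum_prog S x i a) (\<lambda>s'. s' S 0 = (\<Sum>j<N. f j)) s"
  unfolding sum_prog_def
proof (rule wp_Seq, rule wp_Write, goal_cases)
  case 2
  have a': "aval a (s(S := h)) = aval a s" for h
    by (rule aval_cong) (use a(2) in auto)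
  show ?case
  proof (rule wp_For[where N = N and Inv = "\<lambda>k s. s S 0 = (\<Sum>j<k. f j)"], goal_cases)
    case (7 k s')
    then have "s' x = s x" using d by simp
    then have *: "s' x (int k) = f k" using stored_read[OF x 7(1)] by simp
    have "(\<Sum>j<Suc k. f j) \<le> (\<Sum>j<N. f j)" by (rule sum_mono2) (use 7 le in auto)
    moreover have "0 \<le> (\<Sum>j<Suc k. f j)" by (rule sum_nonneg) (use 7 le in auto)
    ultimately show ?case
      using 7 * le(2) by (intro wp_Write) auto
  qed (use a d a' in auto)
qed (use B_nonneg in simp)


lemma worth_bound:
  assumes "\<And>k. 0 \<le> yv k" "\<And>k. yv k \<le> ymax"
  shows "worth yv e \<le> int n * (ymax * (G * G))"
proof -
  have "worth yv e \<le> (\<Sum>k<n. ymax * (G * G))"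
    unfolding worth_def using assms reduced_nonneg reduced_le H_nonneg
    by (intro sum_mono mult_mono) auto
  then show ?thesis by simp
qed

lemma wp_worth:
  assumes i: "s ''input'' = inp" and w: "stored s ''w'' (n * m) reduced" and y: "stored s ''y'' n yv"
    and yv: "\<And>k. 0 \<le> yv k" "\<And>k. yv k \<le> ymax"
  shows "wp worth_prog (\<lambda>s'. stored s' ''v'' m (worth yv)) s"
  unfolding worth_prog_def
proof (rule wp_For[where N = m and Inv = "\<lambda>e s. stored s ''v'' e (worth yv)"], goal_cases)
  case (7 e s1)
  then have fr: "s1 ''input'' = inp" "s1 ''w'' = s ''w''" "s1 ''y'' = s ''y''" using i by simp_all
  show ?case
  proof (rule wp_Seq, rule wp_Write, goal_cases)
    case 2
    let ?f = "\<lambda>k. yv k * reduced (k * m + e)"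
    \<comment> \<open>The inner loop writes \<open>v\<close> itself, so its invariant must also
      carry the prefix computed for earlier items.\<close>
    show ?case
    proof (rule wp_For[where N = n and Inv = "\<lambda>k s. s ''v'' (int e) = (\<Sum>j<k. ?f j) \<and> stored s ''v'' e (worth yv)"], goal_cases)
      case (7 k s2)
      then have fr2: "s2 ''input'' = inp" "s2 ''w'' = s ''w''" "s2 ''y'' = s ''y''" "s2 ''e'' 0 = int e"
        using fr \<open>s1 ''e'' 0 = int e\<close> by simp_all
      have w': "s ''w'' (int k * int m + int e) = reduced (k * m + e)"
        by (rule stored_read[OF w flat_index_less[OF 7(1) \<open>e < m\<close>]]) simp
      have y': "s ''y'' (int k) = yv k" by (rule stored_read[OF y 7(1)]) simp
      have nonneg: "0 \<le> ?f j" for j using yv(1) reduced_nonneg by simp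
      have "(\<Sum>j<Suc k. ?f j) \<le> worth yv e"
        unfolding worth_def by (rule sum_mono2) (use 7(1) nonneg in auto)
      moreover have "0 \<le> (\<Sum>j<Suc k. ?f j)" by (intro sum_nonneg nonneg)
      ultimately have "\<bar>\<Sum>j<Suc k. ?f j\<bar> \<le> B"
        using worth_bound[of yv e, OF yv] worth_le by (intro abs_le_B) auto
      then show ?case
        using 7(2,3) by (intro wp_Write) (auto simp: aval_simps fr2 w' y' stored_def)
    next
      case (8 s2)
      then show ?case by (simp add: stored_def less_Suc_eq worth_def)
    qed (use 7 fr n_le in \<open>auto simp: aval_simps stored_def\<close>)
  qed (use B_nonneg in simp)
qed (use i m_le in \<open>auto simp: aval_simps\<close>)

text \<open>Indexed by flat addresses, so that \<open>stored\<close> applies; quotient and remainder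
  by the row length recover item count and demand.\<close>

definition table :: "(nat \<Rightarrow> int) \<Rightarrow> nat \<Rightarrow> nat \<Rightarrow> int" where
  "table v p c = min_size cap size v (c div Suc p) (int (c mod Suc p))"

lemma table_eq: "j \<le> p \<Longrightarrow> table v p (e * Suc p + j) = min_size cap size v e (int j)"
  by (simp add: table_def del: mult_Suc_right)

lemma cell: "int e * (int p + 1) + int j = int (e * Suc p + j)"
  by (simp add: algebra_simps)

lemma table_bounds:
  assumes "\<And>e. 0 \<le> v e"
  shows "0 \<le> table v p c" "table v p c \<le> B"
proof -
  interpret kn: knapsack cap size v
    by unfold_locales (auto simp: scaled_nonneg assms)
  show "0 \<le> table v p c" "table v p c \<le> B"
    using kn.min_size_bounds[of "c div Suc p" "int (c mod Suc p)"] cap_less unfolding table_def by auto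
qed

lemma wp_rest:
  assumes "s ''v'' (s ''e'' 0) = ve" "0 \<le> ve" "0 \<le> aval a s" "aval a s \<le> int R"
  shows "wp (rest_prog a) (\<lambda>s'. s' ''r'' 0 = max 0 (aval a s - ve)) s"
  unfolding rest_prog_def using assms B_nonneg R_le_B
  by (intro wp_If wp_Write) auto

lemma wp_first_row:
  assumes P: "s ''P'' 0 = int p" "Suc p \<le> R" and x: "s ''x'' 0 = cap"
  shows "wp first_row_prog (\<lambda>s'. stored s' ''A'' (Suc p) (table v p)) s"
  unfolding first_row_prog_def
proof (rule wp_For[where N = "Suc p" and Inv = "\<lambda>j s. stored s ''A'' j (table v p)"], goal_cases)
  case (7 j s')
  then have fr: "s' ''x'' 0 = cap" using x by simp
  have t: "table v p j = (if j = 0 then 0 else cap + 1)"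
    using table_eq[of j p v 0] 7(1) by auto
  show ?case
    using 7(2,3) fr t cap_less scaled_nonneg[of 0] B_nonneg
    by (intro wp_If wp_Write stored_Suc) auto
qed (use P in auto)

text \<open>The row is written directly behind the previous ones, and both entries that a cell
  depends on lie in the row before it, hence in the prefix already stored.\<close>

lemma wp_row:
  assumes P: "s ''P'' 0 = int p" "Suc p \<le> R" and x: "stored s ''x'' cnt scaled"
    and e: "s ''e'' 0 = int e" "e < m" and v: "stored s ''v'' m v" "\<And>e. 0 \<le> v e"
    and A: "stored s ''A'' (Suc e * Suc p) (table v p)"
  shows "wp row_prog (\<lambda>s'. stored s' ''A'' (Suc (Suc e) * Suc p) (table v p)) s"
  unfolding row_prog_def
proof (rule wp_For[where N = "Suc p" and Inv = "\<lambda>j s. stored s ''A'' (Suc e * Suc p + j) (table v p)"], goal_cases)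
  case (7 j s1)
  then have fr: "s1 ''P'' 0 = int p" "s1 ''x'' = s ''x''" "s1 ''e'' 0 = int e" "s1 ''v'' = s ''v''"
    using P e by simp_all
  have ve: "s ''v'' (int e) = v e" by (rule stored_read[OF v(1) e(2)]) simp
  have rest: "wp (rest_prog (Var ''j'')) (\<lambda>s'. s' ''r'' 0 = max 0 (aval (Var ''j'') s1 - v e)) s1"
    by (rule wp_rest) (use 7(1,3) fr ve v P in auto)
  show ?case
  proof (rule wp_Seq, rule wp_mono_frame[OF rest], goal_cases)
    case (1 s2)
    let ?q = "nat (max 0 (int j - v e))"
    \<comment> \<open>Item values are nonnegative, so the reduced demand stays inside the
      columns.\<close>
    have q: "?q \<le> p" "int ?q = max 0 (int j - v e)" using 7(1) v(2)[of e] by auto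
    have fr2: "s2 ''P'' 0 = int p" "s2 ''x'' = s ''x''" "s2 ''e'' 0 = int e" "s2 ''A'' = s1 ''A''"
      "s2 ''j'' 0 = int j" "s2 ''r'' 0 = int ?q"
      using 1 fr 7(3) q by simp_all
    have lt: "e * Suc p + i < Suc e * Suc p + j" if "i \<le> p" for i using that by simp
    have A1: "s1 ''A'' (int e * (int p + 1) + int i) = min_size cap size v e (int i)" if "i \<le> p" for i
      using stored_read[OF 7(2) lt[OF that] cell] table_eq[OF that] by simp
    have xe: "s ''x'' (1 + int e) = size e"
      by (rule stored_read[OF x]) (use e in \<open>auto simp: cnt_def\<close>)
    have t: "table v p (Suc e * Suc p + j) =
        min (min_size cap size v e (int j)) (min_size cap size v e (int ?q) + size e)"
      using table_eq[of j p v "Suc e"] 7(1) q(2) by simp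
    have tb: "\<bar>table v p (Suc e * Suc p + j)\<bar> \<le> B"
      using table_bounds[of v p "Suc e * Suc p + j"] v(2) by simp
    have take: "aval takeE s2 = min_size cap size v e (int ?q) + size e"
      using A1[OF q(1)] xe by (simp add: fr2)
    have skip: "aval skipE s2 = min_size cap size v e (int j)"
      using A1[of j] 7(1) by (simp add: fr2)
    have cell': "aval cellE s2 = int (Suc e * Suc p + j)"
      by (simp add: fr2 algebra_simps)
    have A2: "stored s2 ''A'' (Suc e * Suc p + j) (table v p)"
      using 7(2) fr2(4) stored_cong[of s2 "''A''" s1] by simp
    show ?case
    proof (rule wp_If)
      assume "bval (Less takeE skipE) s2"
      then have eq: "aval takeE s2 = table v p (Suc e * Suc p + j)" unfolding bval.simps take skip t by simp
      show "wp (Write ''A'' cellE takeE) (\<lambda>s. stored s ''A'' (Suc e * Suc p + Suc j) (table v p)) s2"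
        unfolding add_Suc_right by (rule wp_Write) (use eq tb stored_Suc[OF A2 cell' eq] in simp_all)
    next
      assume "\<not> bval (Less takeE skipE) s2"
      then have eq: "aval skipE s2 = table v p (Suc e * Suc p + j)" unfolding bval.simps take skip t by simp
      show "wp (Write ''A'' cellE skipE) (\<lambda>s. stored s ''A'' (Suc e * Suc p + Suc j) (table v p)) s2"
        unfolding add_Suc_right by (rule wp_Write) (use eq tb stored_Suc[OF A2 cell' eq] in simp_all)
    qed
  qed
next
  case (8 s1)
  have "Suc e * Suc p + Suc p = Suc (Suc e) * Suc p" by simp
  with 8(1) show ?case by (simp only:)
qed (use P A in auto)

lemma wp_table:
  assumes i: "s ''input'' = inp" and P: "s ''P'' 0 = int p" "Suc p \<le> R"
    and x: "stored s ''x'' cnt scaled" and v: "stored s ''v'' m v" "\<And>e. 0 \<le> v e"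
  shows "wp table_prog (\<lambda>s'. stored s' ''A'' (Suc m * Suc p) (table v p)) s"
  unfolding table_prog_def
proof (rule wp_Seq, rule wp_mono_frame[OF wp_first_row[where v = v and p = p]], goal_cases)
  case 3
  show ?case by (rule stored_read[OF x]) (auto simp: cnt_def)
next
  case (4 s1)
  then have fr: "s1 ''input'' = inp" "s1 ''P'' 0 = int p" "s1 ''x'' = s ''x''" "s1 ''v'' = s ''v''"
    using i P by simp_all
  show ?case
  proof (rule wp_For[where N = m and Inv = "\<lambda>e s. stored s ''A'' (Suc e * Suc p) (table v p)"], goal_cases)
    case (7 e s2)
    then have fr2: "s2 ''P'' 0 = int p" "s2 ''x'' = s ''x''" "s2 ''v'' = s ''v''" using fr by simp_all
    show ?case
      by (rule wp_row) (use 7 P v x fr2 stored_cong[of s2 "''x''" s] stored_cong[of s2 "''v''" s] in auto)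
  qed (use 4(1) fr m_le in \<open>auto simp: aval_simps\<close>)
qed (use P in auto)

lemma wp_scan:
  assumes i: "s ''input'' = inp" and P: "s ''P'' 0 = int p" "Suc p \<le> R" "int p = (\<Sum>e<m. v e)"
    and x: "s ''x'' 0 = cap" and A: "stored s ''A'' (Suc m * Suc p) (table v p)"
  shows "wp scan_prog (\<lambda>s'. s' ''b'' 0 = max_value cap size v m) s"
  unfolding scan_prog_def
proof (rule wp_Seq, rule wp_Write, goal_cases)
  case 2
  show ?case
  proof (rule wp_For[where N = "Suc p" and
        Inv = "\<lambda>j s. s ''b'' 0 = last_within (min_size cap size v m) cap j"], goal_cases)
    case (7 j s1)
    then have fr: "s1 ''input'' = inp" "s1 ''P'' 0 = int p" "s1 ''x'' 0 = cap" "s1 ''A'' = s ''A''"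
      using i P x by simp_all
    have lt: "m * Suc p + j < Suc m * Suc p" using 7(1) by simp
    have A': "s ''A'' (int m * (int p + 1) + int j) = min_size cap size v m (int j)"
      using stored_read[OF A lt cell] table_eq[of j p v m] 7(1) by simp
    show ?case
      using 7(1-3) P(2) R_le_B by (intro wp_If wp_Write wp_Skip) (auto simp: aval_simps fr A')
  next
    case (8 s1)
    then show ?case by (simp add: max_value_def P(3)[symmetric])
  qed (use i P in auto)
qed (use B_nonneg in simp)

lemma wp_backtrack:
  assumes i: "s ''input'' = inp" and P: "s ''P'' 0 = int p" "Suc p \<le> R" "int p = (\<Sum>e<m. v e)"
    and v: "stored s ''v'' m v" "\<And>e. 0 \<le> v e"
    and A: "stored s ''A'' (Suc m * Suc p) (table v p)"
    and b: "s ''b'' 0 = max_value cap size v m"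
  shows "wp backtrack_prog (\<lambda>s'. stored s' ''z'' m (\<lambda>e. of_bool (e \<in> best_set cap size v m))) s"
  unfolding backtrack_prog_def
proof (rule wp_Seq, rule wp_Write, goal_cases)
  case 1
  show ?case using b max_value_bounds[of v cap size m] v(2) P(2,3) by (intro abs_le_B) auto
next
  case 2
  let ?S = "best_set cap size v m"
  \<comment> \<open>The decisions for the last \<open>i\<close> items are final; \<open>r\<close>
    holds the residual demand \<open>j\<close>, from which backtracking over the other items yields
    the rest of the set.\<close>
  let ?Inv = "\<lambda>i s. \<exists>j\<le>p. s ''r'' 0 = int j \<and>
      (\<forall>e<m - i. e \<in> ?S \<longleftrightarrow> e \<in> backtrack cap size v (m - i) (int j)) \<and>
      (\<forall>e<m. m - i \<le> e \<longrightarrow> s ''z'' (int e) = of_bool (e \<in> ?S))"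
  interpret kn: knapsack cap size v
    by unfold_locales (auto simp: scaled_nonneg v)
  show ?case
  proof (rule wp_For[where N = m and Inv = ?Inv], goal_cases)
    case 6
    show ?case
      using b max_value_bounds[of v cap size m] v(2) P(3)
      by (intro exI[of _ "nat (max_value cap size v m)"]) (auto simp: best_set_def nat_le_iff)
  next
    case (7 i s1)
    define e where "e = m - Suc i"
    have e: "e < m" "Suc e = m - i" "m - Suc i = e" "int m - 1 - int i = int e"
      using 7(1) by (auto simp: e_def)
    from 7(2) obtain j where j: "j \<le> p" "s1 ''r'' 0 = int j"
      "\<And>e'. e' < Suc e \<Longrightarrow> e' \<in> ?S \<longleftrightarrow> e' \<in> backtrack cap size v (Suc e) (int j)"
      "\<And>e'. e' < m \<Longrightarrow> Suc e \<le> e' \<Longrightarrow> s1 ''z'' (int e') = of_bool (e' \<in> ?S)"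
      unfolding e(2) by blast
    have fr: "s1 ''input'' = inp" "s1 ''P'' 0 = int p" "s1 ''A'' = s ''A''" "s1 ''v'' = s ''v''"
      using 7(4) i P by (simp_all add: rest_prog_def)
    have lt: "e' * Suc p + j < Suc m * Suc p" if "e' \<le> m" for e'
      using mult_le_mono1[OF that, of "Suc p"] j(1) unfolding mult_Suc by linarith
    have A': "s ''A'' (int e' * (int p + 1) + int j) = min_size cap size v e' (int j)" if "e' \<le> m" for e'
      using stored_read[OF A lt[OF that] cell] table_eq[OF j(1)] by simp
    have A_e: "s ''A'' (int e * (int p + 1) + int j) = min_size cap size v e (int j)"
      "s ''A'' ((int e + 1) * (int p + 1) + int j) = min_size cap size v (Suc e) (int j)"
      using A'[of e] A'[of "Suc e"] e(1) by (simp_all add: add.commute)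
    have v_e: "s ''v'' (int e) = v e" by (rule stored_read[OF v(1) e(1)]) simp
    have bt: "backtrack cap size v e j' \<subseteq> {..<e}" for j' by (rule kn.backtrack_subset)
    show ?case
    proof (rule wp_Seq, rule wp_Write, goal_cases)
      case 1
      show ?case using 7(1,3) fr e m_le by (intro abs_le_B) (auto simp: aval_simps)
    next
      case 2
      let ?s2 = "s1(''e'' := (s1 ''e'')(0 := int e))"
      have s2: "s1(''e'' := (s1 ''e'')(aval (Num 0) s1 := aval (Minus (Minus mE (Num 1)) (Var ''i'')) s1)) = ?s2"
        using 7(3) fr e(4) by (simp add: aval_simps)
      show ?case
        unfolding s2
      proof (rule wp_If, goal_cases)
        case 1
        then have less: "min_size cap size v (Suc e) (int j) < min_size cap size v e (int j)"
          using A_e by (simp add: fr j(2) del: min_size.simps)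
        then have bt_eq: "backtrack cap size v (Suc e) (int j)
            = insert e (backtrack cap size v e (max 0 (int j - v e)))"
          by (simp del: min_size.simps)
        show ?case
        proof (rule wp_Seq, rule wp_Write, goal_cases)
          case 2
          let ?s3 = "?s2(''z'' := (?s2 ''z'')(aval (Var ''e'') ?s2 := aval (Num 1) ?s2))"
          have rest: "wp (rest_prog (Var ''r'')) (\<lambda>s'. s' ''r'' 0 = max 0 (aval (Var ''r'') ?s3 - v e)) ?s3"
            by (rule wp_rest) (use fr v_e v(2) j P(2) in auto)
          show ?case
          proof (rule wp_mono_frame[OF rest], goal_cases)
            case (1 s4)
            then have "s4 ''z'' = (s1 ''z'')(int e := 1)" by simp
            moreover have "s4 ''r'' 0 = int (nat (max 0 (int j - v e)))" using 1(1) j(2) by simp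
            moreover have "nat (max 0 (int j - v e)) \<le> p" using j(1) v(2)[of e] by simp
            moreover have "e \<in> ?S" using j(3)[of e] bt_eq by simp
            moreover have "e' \<in> ?S \<longleftrightarrow> e' \<in> backtrack cap size v e (max 0 (int j - v e))" if "e' < e" for e'
              using j(3)[of e'] bt_eq that by simp
            ultimately show ?case
              unfolding e(3) using j(4) by (intro exI[of _ "nat (max 0 (int j - v e))"]) auto
          qed
        qed (use R_pos R_le_B in simp)
      next
        case 2
        then have not_less: "\<not> min_size cap size v (Suc e) (int j) < min_size cap size v e (int j)"
          using A_e by (simp add: fr j(2) del: min_size.simps)
        then have bt_eq: "backtrack cap size v (Suc e) (int j) = backtrack cap size v e (int j)"
          by (simp del: min_size.simps)
        show ?case
        proof (rule wp_Write, goal_cases)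
          case 2
          have "e \<notin> ?S" using j(3)[of e] bt_eq bt by auto
          moreover have "e' \<in> ?S \<longleftrightarrow> e' \<in> backtrack cap size v e (int j)" if "e' < e" for e'
            using j(3)[of e'] bt_eq that by simp
          ultimately show ?case
            unfolding e(3) using j(1,2,4) by (intro exI[of _ j]) auto
        qed (use B_nonneg in simp)
      qed
    qed
  next
    case (8 s1)
    from 8(1) show ?case by (auto simp: stored_def)
  next
    case (5 k s v)
    show ?case by simp
  qed (use i m_le in \<open>auto simp: aval_simps rest_prog_def\<close>)
qed


section \<open>Writing the output and updating the deficits\<close>

definition output_cells :: "nat \<Rightarrow> int" where
  "output_cells c = (case c of 0 \<Rightarrow> int rounds
     | Suc c \<Rightarrow> (let j = c mod (m + 2) in
         if j = 0 then 1 else if j = 1 then int rounds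
         else of_bool (j - 2 \<in> choice (deficit (c div (m + 2))))))"

lemma output_cells_entry:
  "output_cells (Suc (t * (m + 2))) = 1"
  "output_cells (Suc (Suc (t * (m + 2)))) = int rounds"
  "e < m \<Longrightarrow> output_cells (Suc (Suc (Suc (t * (m + 2) + e)))) = of_bool (e \<in> choice (deficit t))"
proof -
  have "(t * (m + 2) + j) mod (m + 2) = j" "(t * (m + 2) + j) div (m + 2) = t" if "j < m + 2" for j
    using that by (simp_all del: mult_Suc_right add_2_eq_Suc')
  from this[of 0] this[of 1] this[of "2 + e"]
  show "output_cells (Suc (t * (m + 2))) = 1"
    "output_cells (Suc (Suc (t * (m + 2)))) = int rounds"
    "e < m \<Longrightarrow> output_cells (Suc (Suc (Suc (t * (m + 2) + e)))) = of_bool (e \<in> choice (deficit t))"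
    unfolding output_cells_def by (simp_all add: Let_def del: mult_Suc_right add_2_eq_Suc' mod_mult_self1 mod_mult_self2 mod_mult_self3 mod_mult_self4)
qed

lemma output_cells_0: "output_cells 0 = int rounds"
  by (simp add: output_cells_def)

lemma wp_output:
  assumes i: "s ''input'' = inp" "s ''precision'' = pr" and t: "s ''t'' 0 = int t"
    and z: "stored s ''z'' m (\<lambda>e. of_bool (e \<in> choice (deficit t)))"
    and out: "stored s ''output'' (Suc (t * (m + 2))) output_cells"
  shows "wp output_prog (\<lambda>s'. stored s' ''output'' (Suc (Suc t * (m + 2))) output_cells) s"
  unfolding output_prog_def
proof (rule wp_Seq, rule wp_Write, goal_cases)
  case 2
  let ?c = "Suc (t * (m + 2))"
  have entry: "aval entryE s' = int ?c" if "s' ''input'' = inp" "s' ''t'' 0 = int t" for s'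
    using that t by (simp add: aval_simps algebra_simps)
  let ?s1 = "s(''output'' := (s ''output'')(aval entryE s := aval (Num 1) s))"
  have 1: "stored ?s1 ''output'' (Suc ?c) output_cells"
    by (rule stored_Suc[OF out]) (use entry i t output_cells_entry(1)[of t] in auto)
  show ?case
  proof (rule wp_Seq, rule wp_Write, goal_cases)
    case 1
    show ?case using rounds_le R_le_B i by (simp add: aval_G)
  next
    case 2
    let ?s2 = "?s1(''output'' := (?s1 ''output'')(aval (Plus entryE (Num 1)) ?s1 := aval TE ?s1))"
    have 2: "stored ?s2 ''output'' (Suc (Suc ?c)) output_cells"
    proof (rule stored_Suc[OF 1])
      show "aval (Plus entryE (Num 1)) ?s1 = int (Suc ?c)" using entry[of ?s1] i t by simp
      show "aval TE ?s1 = output_cells (Suc ?c)" using i output_cells_entry(2)[of t] by (simp add: aval_G)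
    qed
    have fr2: "?s2 ''input'' = inp" "?s2 ''t'' 0 = int t" "?s2 ''z'' = s ''z''" using i t by simp_all
    show ?case
    proof (rule wp_For[where N = m and
          Inv = "\<lambda>e s. stored s ''output'' (Suc (Suc ?c) + e) output_cells"], goal_cases)
      case (7 e s3)
      have fr: "s3 ''input'' = inp" "s3 ''t'' 0 = int t" "s3 ''z'' = s ''z''"
        using 7(4) fr2 by (auto simp del: fun_upd_apply)
      have z': "s ''z'' (int e) = of_bool (e \<in> choice (deficit t))"
        by (rule stored_read[OF z 7(1)]) simp
      have addr: "aval (Plus (Plus entryE (Num 2)) (Var ''e'')) s3 = int (Suc (Suc ?c) + e)"
        using entry[OF fr(1,2)] 7(3) by simp
      show ?case
        unfolding add_Suc_right
      proof (rule wp_Write, goal_cases)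
        case 1
        show ?case using z' fr(3) 7(3) R_pos R_le_B by simp
      next
        case 2
        show ?case
          by (rule stored_Suc[OF 7(2) addr]) (use z' fr(3) 7(3) output_cells_entry(3)[OF 7(1), of t] in simp)
      qed
    next
      case 6
      show ?case using 2 by (simp only: add_0_right)
    next
      case (8 s3)
      have "Suc (Suc ?c) + m = Suc (Suc t * (m + 2))" by simp
      with 8(1) show ?case by (simp only:)
    next
      case 3
      show ?case by (rule aval_simps(2)) (rule fr2(1))
    qed (use m_le in auto)
  qed
qed (use R_pos R_le_B in simp)

lemma choice_subset: "choice (deficit t) \<subseteq> {..<m}"
  using choice_feasible[OF deficit_nonneg] by (simp add: feasible_def)

lemma sum_of_bool_mult:
  fixes l :: nat
  assumes "S \<subseteq> {..<l}"
  shows "(\<Sum>e<l. of_bool (e \<in> S) * f e) = (\<Sum>e\<in>S. (f e :: int))"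
proof -
  have "(\<Sum>e<l. of_bool (e \<in> S) * f e) = (\<Sum>e<l. if e \<in> S then f e else 0)"
    by (intro sum.cong) auto
  also have "\<dots> = sum f ({..<l} \<inter> S)" by (rule sum.inter_restrict[symmetric]) (rule finite_lessThan)
  also have "{..<l} \<inter> S = S" using assms by auto
  finally show ?thesis .
qed

text \<open>Overwriting the deficits in place is sound: \<open>b\<close> and \<open>Y\<close> were
  computed from the old ones, and each step reads only the deficit it replaces.\<close>

lemma wp_update:
  assumes i: "s ''input'' = inp" and w: "stored s ''w'' (n * m) reduced"
    and y: "stored s ''y'' n (deficit t)" and t: "t < rounds"
    and z: "stored s ''z'' m (\<lambda>e. of_bool (e \<in> choice (deficit t)))"
    and b: "s ''b'' 0 = max_value cap size (worth (deficit t)) m"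
    and Y: "s ''Y'' 0 = (\<Sum>k<n. deficit t k)"
  shows "wp update_prog (\<lambda>s'. stored s' ''y'' n (deficit (Suc t))) s"
  unfolding update_prog_def
proof (rule wp_For[where N = n and
      Inv = "\<lambda>k s. \<forall>j<n. s ''y'' (int j) = (if j < k then deficit (Suc t) j else deficit t j)"], goal_cases)
  case (7 k s1)
  have fr: "s1 ''input'' = inp" "s1 ''w'' = s ''w''" "s1 ''z'' = s ''z''" "s1 ''b'' = s ''b''" "s1 ''Y'' = s ''Y''"
    using 7(4) i by auto
  let ?S = "choice (deficit t)"
  let ?g = "\<lambda>e. of_bool (e \<in> ?S) * reduced (k * m + e)"
  let ?c = "Seq (Set ''f'' (Num 0))
      (For ''e'' mE (Set ''f'' (Plus (Var ''f'') (Times (Read ''z'' (Var ''e'')) redE))))"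
  have total: "(\<Sum>e<m. ?g e) = gain k ?S"
    by (rule sum_of_bool_mult[OF choice_subset])
  have f: "wp ?c (\<lambda>s'. s' ''f'' 0 = gain k ?S) s1"
  proof (rule wp_Seq, rule wp_Write, goal_cases)
    case 2
    show ?case
    proof (rule wp_For[where N = m and Inv = "\<lambda>e s. s ''f'' 0 = (\<Sum>j<e. ?g j)"], goal_cases)
      case (7 e s2)
      have fr2: "s2 ''input'' = inp" "s2 ''w'' = s ''w''" "s2 ''z'' = s ''z''" "s2 ''k'' 0 = int k"
        using 7(4) fr \<open>s1 ''k'' 0 = int k\<close> by auto
      have w': "s ''w'' (int k * int m + int e) = reduced (k * m + e)"
        by (rule stored_read[OF w flat_index_less[OF \<open>k < n\<close> \<open>e < m\<close>]]) simp
      have z': "s ''z'' (int e) = of_bool (e \<in> ?S)" by (rule stored_read[OF z 7(1)]) simp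
      have "(\<Sum>j<Suc e. ?g j) \<le> (\<Sum>j<m. ?g j)"
        by (rule sum_mono2) (use 7(1) reduced_nonneg in auto)
      also have "\<dots> \<le> H" unfolding total by (rule gain_bounds[OF choice_subset])
      finally have "(\<Sum>j<Suc e. ?g j) \<le> H" .
      moreover have "0 \<le> (\<Sum>j<Suc e. ?g j)" using reduced_nonneg by (intro sum_nonneg) auto
      ultimately have "\<bar>\<Sum>j<Suc e. ?g j\<bar> \<le> B" using H_le by (intro abs_le_B) auto
      then show ?case
        using 7(2,3) by (intro wp_Write) (auto simp: aval_simps fr2 w' z')
    next
      case (8 s2)
      from 8(1) show ?case using total by simp
    qed (use fr m_le in \<open>auto simp: aval_simps\<close>)
  qed (use B_nonneg in simp)
  show ?case
  proof (rule wp_Seq, rule wp_mono_frame[OF f], goal_cases)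
    case (1 s2)
    have fr2: "s2 ''b'' 0 = max_value cap size (worth (deficit t)) m" "s2 ''Y'' 0 = (\<Sum>k<n. deficit t k)"
      "s2 ''k'' 0 = int k" "s2 ''y'' = s1 ''y''"
      using 1(2) fr b Y 7(3) by auto
    have y1: "s1 ''y'' (int k) = deficit t k" using 7(1,2) by auto
    have new: "aval newE s2 = deficit t k + target (deficit t) - gain k ?S"
      using 1(1) y1 by (simp add: fr2 target_def)
    have next_eq: "deficit (Suc t) k = max 1 (aval newE s2)" unfolding new by simp
    have "deficit (Suc t) k \<le> 1 + int (Suc t) * H" by (rule deficit_le)
    also have "\<dots> \<le> ymax" using t H_nonneg by (intro add_left_mono mult_right_mono) auto
    finally have le: "\<bar>deficit (Suc t) k\<bar> \<le> B"
      using deficit_nonneg[of "Suc t" k] ymax_le by (intro abs_le_B) auto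
    have upd: "\<forall>j<n. (s2(''y'' := (s2 ''y'')(int k := v))) ''y'' (int j) =
        (if j < Suc k then deficit (Suc t) j else deficit t j)" if "v = deficit (Suc t) k" for v
      using that 7(2) by (auto simp: fr2 less_Suc_eq)
    have k: "aval (Var ''k'') s2 = int k" using fr2(3) by simp
    show ?case
    proof (rule wp_If)
      assume "bval (Less newE (Num 1)) s2"
      then have eq: "aval (Num 1) s2 = deficit (Suc t) k" unfolding next_eq by simp
      show "wp (Write ''y'' (Var ''k'') (Num 1))
          (\<lambda>s. \<forall>j<n. s ''y'' (int j) = (if j < Suc k then deficit (Suc t) j else deficit t j)) s2"
      proof (rule wp_Write)
        show "\<bar>aval (Num 1) s2\<bar> \<le> B" unfolding eq by (rule le)
        show "\<forall>j<n. (s2(''y'' := (s2 ''y'')(aval (Var ''k'') s2 := aval (Num 1) s2))) ''y'' (int j) =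
            (if j < Suc k then deficit (Suc t) j else deficit t j)"
          unfolding k by (rule upd[OF eq])
      qed
    next
      assume "\<not> bval (Less newE (Num 1)) s2"
      then have eq: "aval newE s2 = deficit (Suc t) k" unfolding next_eq by simp
      show "wp (Write ''y'' (Var ''k'') newE)
          (\<lambda>s. \<forall>j<n. s ''y'' (int j) = (if j < Suc k then deficit (Suc t) j else deficit t j)) s2"
      proof (rule wp_Write)
        show "\<bar>aval newE s2\<bar> \<le> B" unfolding eq by (rule le)
        show "\<forall>j<n. (s2(''y'' := (s2 ''y'')(aval (Var ''k'') s2 := aval newE s2))) ''y'' (int j) =
            (if j < Suc k then deficit (Suc t) j else deficit t j)"
          unfolding k by (rule upd[OF eq])
      qed
    qed
  qed
next
  case (8 s1)
  from 8(1) show ?case by (auto simp: stored_def)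
next
  case 6
  show ?case using y by (simp add: stored_def)
qed (use i n_le in \<open>auto simp: aval_simps\<close>)

lemma wp_round:
  assumes i: "s ''input'' = inp" "s ''precision'' = pr" and x: "stored s ''x'' cnt scaled"
    and w: "stored s ''w'' (n * m) reduced" and t: "s ''t'' 0 = int t" "t < rounds"
    and y: "stored s ''y'' n (deficit t)"
    and out: "stored s ''output'' (Suc (t * (m + 2))) output_cells"
  shows "wp round_prog (\<lambda>s'. stored s' ''y'' n (deficit (Suc t)) \<and>
    stored s' ''output'' (Suc (Suc t * (m + 2))) output_cells) s"
proof -
  let ?y = "deficit t"
  let ?v = "worth ?y"
  let ?p = "nat (\<Sum>e<m. ?v e)"
  have y_le: "?y k \<le> ymax" for k
  proof -
    have "?y k \<le> 1 + int t * H" by (rule deficit_le)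
    also have "\<dots> \<le> ymax" using t(2) H_nonneg by (intro add_left_mono mult_right_mono) auto
    finally show ?thesis .
  qed
  have v_nonneg: "0 \<le> ?v e" for e by (rule worth_nonneg) (rule deficit_nonneg)
  have "(\<Sum>k<n. ?y k) \<le> of_nat (card {..<n}) * ymax" by (rule sum_bounded_above) (rule y_le)
  then have Y_le: "(\<Sum>k<n. ?y k) \<le> B" using ysum_le R_le_B by simp
  have "(\<Sum>e<m. ?v e) \<le> of_nat (card {..<m}) * (int n * (ymax * (G * G)))"
    by (rule sum_bounded_above) (rule worth_bound[OF deficit_nonneg y_le])
  \<comment> \<open>Strictness leaves room for the additional column with demand 0.\<close>
  then have P_less: "(\<Sum>e<m. ?v e) < int R" using table_le by simp
  have P_nonneg: "0 \<le> (\<Sum>e<m. ?v e)" by (intro sum_nonneg v_nonneg)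
  have p: "int ?p = (\<Sum>e<m. ?v e)" "Suc ?p \<le> R" using P_less P_nonneg by linarith+
  show ?thesis
    unfolding round_prog_def
  proof (rule wp_Seq, rule wp_mono_frame[OF wp_sum[where N = n and f = ?y]], goal_cases)
    case (10 s1)
    have fr1: "s1 ''input'' = inp" "s1 ''precision'' = pr" "s1 ''x'' = s ''x''" "s1 ''w'' = s ''w''"
      "s1 ''t'' 0 = int t" "s1 ''y'' = s ''y''" "s1 ''output'' = s ''output''"
      using 10(2) i t by auto
    show ?case
    proof (rule wp_Seq, rule wp_mono_frame[OF wp_worth[where yv = ?y]], goal_cases)
      case (6 s2)
      have fr2: "s2 ''input'' = inp" "s2 ''precision'' = pr" "s2 ''x'' = s ''x''" "s2 ''w'' = s ''w''"
        "s2 ''t'' 0 = int t" "s2 ''y'' = s ''y''" "s2 ''output'' = s ''output''" "s2 ''Y'' = s1 ''Y''"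
        using 6(2) fr1 by auto
      show ?case
      proof (rule wp_Seq, rule wp_mono_frame[OF wp_sum[where N = m and f = ?v]], goal_cases)
        case (10 s3)
        have fr3: "s3 ''input'' = inp" "s3 ''precision'' = pr" "s3 ''x'' = s ''x''" "s3 ''w'' = s ''w''"
          "s3 ''t'' 0 = int t" "s3 ''y'' = s ''y''" "s3 ''output'' = s ''output''" "s3 ''Y'' = s1 ''Y''"
          "s3 ''v'' = s2 ''v''"
          using 10(2) fr2 by auto
        have P: "s3 ''P'' 0 = int ?p" using 10(1) p(1) by simp
        have x3: "stored s3 ''x'' cnt scaled" using x fr3(3) by (simp add: stored_def)
        have v3: "stored s3 ''v'' m ?v" using 6(1) fr3(9) by (simp add: stored_def)
        show ?case
        proof (rule wp_Seq, rule wp_mono_frame[OF wp_table[of s3 ?p ?v, OF fr3(1) P p(2) x3 v3 v_nonneg]], goal_cases)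
          case (1 s4)
          have fr4: "s4 ''input'' = inp" "s4 ''precision'' = pr" "s4 ''x'' = s ''x''" "s4 ''w'' = s ''w''"
            "s4 ''t'' 0 = int t" "s4 ''y'' = s ''y''" "s4 ''output'' = s ''output''" "s4 ''Y'' = s1 ''Y''"
            "s4 ''v'' = s2 ''v''" "s4 ''P'' 0 = int ?p"
            using 1(2) fr3 P by auto
          have x4: "s4 ''x'' 0 = cap"
            unfolding fr4(3) by (rule stored_read[OF x]) (auto simp: cnt_def)
          show ?case
          proof (rule wp_Seq, rule wp_mono_frame[OF wp_scan[of s4 ?p ?v, OF fr4(1,10) p(2) p(1) x4 1(1)]], goal_cases)
            case (1 s5)
            have fr5: "s5 ''input'' = inp" "s5 ''precision'' = pr" "s5 ''x'' = s ''x''" "s5 ''w'' = s ''w''"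
              "s5 ''t'' 0 = int t" "s5 ''y'' = s ''y''" "s5 ''output'' = s ''output''" "s5 ''Y'' = s1 ''Y''"
              "s5 ''v'' = s2 ''v''" "s5 ''P'' 0 = int ?p" "s5 ''A'' = s4 ''A''"
              using 1(2) fr4 by auto
            have v5: "stored s5 ''v'' m ?v" using 6(1) fr5(9) by (simp add: stored_def)
            have A5: "stored s5 ''A'' (Suc m * Suc ?p) (table ?v ?p)"
              using \<open>stored s4 ''A'' (Suc m * Suc ?p) (table ?v ?p)\<close> fr5(11) stored_cong[of s5 "''A''" s4] by simp
            show ?case
            proof (rule wp_Seq, rule wp_mono_frame[OF wp_backtrack[of s5 ?p ?v, OF fr5(1,10) p(2) p(1) v5 v_nonneg A5 1(1)]], goal_cases)
              case (1 s6)
              have fr6: "s6 ''input'' = inp" "s6 ''precision'' = pr" "s6 ''w'' = s ''w''"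
                "s6 ''t'' 0 = int t" "s6 ''y'' = s ''y''" "s6 ''output'' = s ''output''" "s6 ''Y'' = s1 ''Y''"
                "s6 ''b'' = s5 ''b''"
                using 1(2) fr5 by auto
              have z6: "stored s6 ''z'' m (\<lambda>e. of_bool (e \<in> choice ?y))"
                using 1(1) by (simp add: choice_def)
              have out6: "stored s6 ''output'' (Suc (t * (m + 2))) output_cells"
                using out stored_cong[of s6 "''output''" s] fr6(6) by simp
              show ?case
              proof (rule wp_Seq, rule wp_mono_frame[OF wp_output[of s6 t, OF fr6(1,2,4) z6 out6]], goal_cases)
                case (1 s7)
                have fr7: "s7 ''input'' = inp" "s7 ''w'' = s ''w''" "s7 ''y'' = s ''y''" "s7 ''Y'' = s1 ''Y''"
                  "s7 ''b'' = s5 ''b''" "s7 ''z'' = s6 ''z''"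
                  using 1(2) fr6 by auto
                have upd: "wp update_prog (\<lambda>s'. stored s' ''y'' n (deficit (Suc t))) s7"
                proof (rule wp_update)
                  show "stored s7 ''w'' (n * m) reduced" using w stored_cong[of s7 "''w''" s] fr7(2) by simp
                  show "stored s7 ''y'' n ?y" using y stored_cong[of s7 "''y''" s] fr7(3) by simp
                  show "stored s7 ''z'' m (\<lambda>e. of_bool (e \<in> choice ?y))"
                    using z6 stored_cong[of s7 "''z''" s6] fr7(6) by simp
                  show "s7 ''b'' 0 = max_value cap size ?v m" unfolding fr7(5) by fact
                  show "s7 ''Y'' 0 = (\<Sum>k<n. ?y k)" unfolding fr7(4) by fact
                qed (use fr7 t(2) in auto)
                show ?case
                proof (rule wp_mono_frame[OF upd], goal_cases)
                  case (1 s8)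
                  have "s8 ''output'' = s7 ''output''" using 1(2) by simp
                  with 1(1) \<open>stored s7 ''output'' (Suc (Suc t * (m + 2))) output_cells\<close>
                  show ?case using stored_cong[of s8 "''output''" s7] by simp
                qed
              qed
            qed
          qed
        qed
      next
        case 2
        show ?case by (rule aval_simps(2)) (rule fr2(1))
      qed (use 6(1) m_le v_nonneg P_less R_le_B in auto)
    next
      case 1
      show ?case by (rule fr1(1))
    next
      case 2
      show ?case using w stored_cong[of s1 "''w''" s] fr1(4) by simp
    next
      case 3
      show ?case using y stored_cong[of s1 "''y''" s] fr1(6) by simp
    qed (use y_le deficit_nonneg in auto)
  next
    case 1
    show ?case by (rule y)
  next
    case 2
    show ?case by (rule aval_simps(1)) (rule i(1))
  qed (use n_le deficit_nonneg Y_le in auto)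
qed

theorem wp_fptas:
  assumes i: "s ''input'' = inp" "s ''precision'' = pr"
  shows "wp fptas (\<lambda>s'. stored s' ''output'' (Suc (rounds * (m + 2))) output_cells) s"
  unfolding fptas_def
proof (rule wp_Seq, rule wp_mono_frame[OF wp_scale[of s, OF i(1)]], goal_cases)
  case (1 s1)
  have fr1: "s1 ''input'' = inp" "s1 ''precision'' = pr" using 1(2) i by auto
  note x1 = 1(1)
  show ?case
  proof (rule wp_Seq, rule wp_mono_frame[OF wp_least_best[of s1, OF fr1(1) x1]], goal_cases)
    case (1 s2)
    have fr2: "s2 ''input'' = inp" "s2 ''precision'' = pr" "s2 ''x'' = s1 ''x''" using 1(2) fr1 by auto
    have x2: "stored s2 ''x'' cnt scaled" using x1 stored_cong[of s2 "''x''" s1] fr2(3) by simp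
    show ?case
    proof (rule wp_Seq, rule wp_mono_frame[OF wp_reduce[of s2, OF fr2(1,2) x2 1(1)]], goal_cases)
      case (1 s3)
      have fr3: "s3 ''input'' = inp" "s3 ''precision'' = pr" "s3 ''x'' = s1 ''x''" using 1(2) fr2 by auto
      note w3 = 1(1)
      have init: "wp (For ''k'' nE (Write ''y'' (Var ''k'') (Num 1))) (\<lambda>s. stored s ''y'' n (deficit 0)) s3"
      proof (rule wp_For[where N = n and Inv = "\<lambda>k s. stored s ''y'' k (deficit 0)"], goal_cases)
        case (7 k s')
        then show ?case
          using R_pos R_le_B by (intro wp_Write stored_Suc) auto
      qed (use fr3 n_le in \<open>auto simp: aval_simps\<close>)
      show ?case
      proof (rule wp_Seq, rule wp_mono_frame[OF init], goal_cases)
        case (1 s4)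
        have fr4: "s4 ''input'' = inp" "s4 ''precision'' = pr" "s4 ''x'' = s1 ''x''" "s4 ''w'' = s3 ''w''"
          using 1(2) fr3 by auto
        note y4 = 1(1)
        show ?case
        proof (rule wp_Seq, rule wp_Write, goal_cases)
          case 1
          show ?case using rounds_le R_le_B fr4 by (simp add: aval_G)
        next
          case 2
          let ?s5 = "s4(''output'' := (s4 ''output'')(aval (Num 0) s4 := aval TE s4))"
          have out5: "stored ?s5 ''output'' (Suc 0) output_cells"
            by (rule stored_Suc) (use fr4 output_cells_0 in \<open>auto simp: aval_G\<close>)
          show ?case
          proof (rule wp_For[where N = rounds and Inv = "\<lambda>t s. stored s ''y'' n (deficit t) \<and>
                stored s ''output'' (Suc (t * (m + 2))) output_cells"], goal_cases)
            case (7 t s6)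
            have fr6: "s6 ''input'' = inp" "s6 ''precision'' = pr" "s6 ''x'' = s1 ''x''" "s6 ''w'' = s3 ''w''"
              using 7(4) fr4 by auto
            show ?case
            proof (rule wp_round)
              show "stored s6 ''x'' cnt scaled" using x1 stored_cong[of s6 "''x''" s1] fr6(3) by simp
              show "stored s6 ''w'' (n * m) reduced" using w3 stored_cong[of s6 "''w''" s3] fr6(4) by simp
            qed (use 7 fr6 in auto)
          next
            case 6
            show ?case using y4 out5 by simp
          next
            case (8 s6)
            from 8(1) show ?case by simp
          next
            case 3
            show ?case using fr4 by (simp add: aval_G)
          qed (use rounds_le in auto)
        qed
      qed
    qed
  qed
qed

end

section \<open>The input\<close>

text \<open>Flattens the data so that the \<open>i\<close>-th rational has its numerator at input
  address \<open>2 + 2 * i\<close> and its denominator right behind, whatever its role.\<close>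

definition rationals :: "instance_data \<Rightarrow> rat list" where
  "rationals I = capacity I # map (item_size I) [0..<items I] @
     concat (map (\<lambda>k. map (weight I k) [0..<items I]) [0..<objectives I])"

lemma concat_map_concat: "concat (map f (concat xss)) = concat (map (\<lambda>xs. concat (map f xs)) xss)"
  by (induction xss) auto

lemma encode_instance_eq:
  "encode_instance I = int (objectives I) # int (items I) # concat (map encode_rat (rationals I))"
  by (simp add: encode_instance_def rationals_def concat_map_concat o_def)

lemma length_concat_rows: "length (concat (map (\<lambda>k. map (f k) [0..<m]) [0..<n])) = n * m"
  by (induction n) auto

lemma nth_concat_rows:
  "k < n \<Longrightarrow> e < m \<Longrightarrow> concat (map (\<lambda>k. map (f k) [0..<m]) [0..<n]) ! (k * m + e) = f k e"
proof (induction n)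
  case (Suc n)
  show ?case
  proof (cases "k < n")
    case True
    with Suc flat_index_less[OF True Suc.prems(2)] show ?thesis
      by (simp add: nth_append length_concat_rows)
  next
    case False
    with Suc.prems have "k = n" by simp
    with Suc.prems show ?thesis by (simp add: nth_append length_concat_rows)
  qed
qed simp

lemma length_encode_rats: "length (concat (map encode_rat rs)) = 2 * length rs"
  by (induction rs) (auto simp: encode_rat_def)

lemma nth_encode_rats:
  "i < length rs \<Longrightarrow> concat (map encode_rat rs) ! (2 * i) = fst (quotient_of (rs ! i))"
  "i < length rs \<Longrightarrow> concat (map encode_rat rs) ! Suc (2 * i) = snd (quotient_of (rs ! i))"
proof (induction rs arbitrary: i)
  case (Cons r rs)
  {
    case 1
    with Cons.IH(1)[of "i - 1"] show ?case by (cases i) (auto simp: encode_rat_def)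
  next
    case 2
    with Cons.IH(2)[of "i - 1"] show ?case by (cases i) (auto simp: encode_rat_def)
  }
qed auto

lemma length_rationals: "length (rationals I) = Suc (items I + objectives I * items I)"
  by (simp add: rationals_def length_concat_rows)

lemma nth_rationals:
  "rationals I ! 0 = capacity I"
  "e < items I \<Longrightarrow> rationals I ! Suc e = item_size I e"
  "k < objectives I \<Longrightarrow> e < items I \<Longrightarrow>
    rationals I ! Suc (items I + (k * items I + e)) = weight I k e"
  by (simp_all add: rationals_def nth_append nth_concat_rows)

lemma abs_le_power_bits: "\<bar>z\<bar> \<le> 2 ^ bits z"
proof -
  have "(2::int) ^ (bits z - 1) \<le> 2 ^ bits z" by (rule power_increasing) auto
  with abs_less_bits[of z] show ?thesis by linarith
qed

locale valid_input =
  fixes I :: instance_data and \<epsilon> :: real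
  assumes valid: "valid_instance I" and eps: "0 < \<epsilon>"
begin

abbreviation enc :: "int list" where
  "enc \<equiv> encode_instance I"

abbreviation Z :: nat where
  "Z \<equiv> input_size I"

abbreviation m :: nat where
  "m \<equiv> items I"

definition n :: nat where
  "n = objectives I * items I div items I"

definition prec :: nat where
  "prec = nat \<lceil>1 / \<epsilon>\<rceil>"

definition x :: nat where
  "x = 1 + Z + prec"

text \<open>Sized by the largest quantity, the bound \<open>66320 * x ^ 30\<close> on the total
  weighted value, with one more unit for strictness.\<close>

definition R :: nat where
  "R = 66321 * x ^ 30"

definition B :: int where
  "B = 2 ^ (2 * Z) + (int R + 1)"

definition inp :: "int \<Rightarrow> int" where
  "inp = initial_store I \<epsilon> ''input''"

definition pr :: "int \<Rightarrow> int" where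
  "pr = initial_store I \<epsilon> ''precision''"

lemma prec_pos: "1 \<le> prec" and int_prec: "int prec = \<lceil>1 / \<epsilon>\<rceil>"
proof -
  have "0 < \<lceil>1 / \<epsilon>\<rceil>" unfolding zero_less_ceiling using eps by simp
  then show "1 \<le> prec" "int prec = \<lceil>1 / \<epsilon>\<rceil>" unfolding prec_def by linarith+
qed

lemma prec_bounds: "1 / real prec \<le> \<epsilon>" "real prec \<le> 1 / \<epsilon> + 1"
proof -
  have "real prec = real_of_int \<lceil>1 / \<epsilon>\<rceil>" using int_prec by (metis of_int_of_nat_eq)
  then have "1 / \<epsilon> \<le> real prec" and "real prec \<le> 1 / \<epsilon> + 1" by linarith+
  then show "1 / real prec \<le> \<epsilon>" "real prec \<le> 1 / \<epsilon> + 1"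
    using eps prec_pos by (simp_all add: field_simps)
qed

lemma n_mult_m: "n * m = objectives I * m"
  by (simp add: n_def)

lemma n_eq: "0 < m \<Longrightarrow> n = objectives I"
  by (simp add: n_def)

lemma length_enc: "length enc = 2 + 2 * length (rationals I)"
  by (simp add: encode_instance_eq length_encode_rats)

lemma inp_nth: "i < length enc \<Longrightarrow> inp (int i) = enc ! i"
  by (simp add: inp_def initial_store_def)

lemma inp_num: "i < length (rationals I) \<Longrightarrow> inp (2 + 2 * int i) = fst (quotient_of (rationals I ! i))"
  using inp_nth[of "2 + 2 * i"] nth_encode_rats(1)[of i "rationals I"]
  by (simp add: length_enc encode_instance_eq length_encode_rats)

lemma inp_den: "i < length (rationals I) \<Longrightarrow> inp (3 + 2 * int i) = snd (quotient_of (rationals I ! i))"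
  using inp_nth[of "3 + 2 * i"] nth_encode_rats(2)[of i "rationals I"]
  by (simp add: length_enc encode_instance_eq length_encode_rats numeral_3_eq_3)

lemma rationals_nonneg: "r \<in> set (rationals I) \<Longrightarrow> 0 \<le> r"
  using valid unfolding valid_instance_def rationals_def by auto

lemma enc_nonneg: "z \<in> set enc \<Longrightarrow> 0 \<le> z"
proof -
  have "0 \<le> fst (quotient_of r)" "0 < snd (quotient_of r)" if "0 \<le> r" for r
  proof -
    obtain a b where ab: "quotient_of r = (a, b)" by force
    with quotient_of_denom_pos[OF ab] quotient_of_div[OF ab] that
    show "0 \<le> fst (quotient_of r)" "0 < snd (quotient_of r)" by (auto simp: zero_le_divide_iff)
  qed
  then show "z \<in> set enc \<Longrightarrow> 0 \<le> z"
    using rationals_nonneg by (fastforce simp: encode_instance_eq encode_rat_def intro: less_imp_le)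
qed

lemma inp_nonneg: "0 \<le> inp (int i)"
proof (cases "i < length enc")
  case True
  then show ?thesis using inp_nth enc_nonneg nth_mem by metis
qed (simp add: inp_def initial_store_def)

sublocale fptas_run R B inp pr n m prec
proof
  have l: "1 < length enc" "0 < length enc" by (simp_all add: length_enc)
  show m': "inp 1 = int m" using inp_nth[OF l(1)] by (simp add: encode_instance_eq)
  have "inp 0 = int (objectives I)" using inp_nth[OF l(2)] by (simp add: encode_instance_eq)
  then show "inp 0 * inp 1 div inp 1 = int n"
    by (simp add: m' n_def of_nat_div)
  show "pr 0 = int prec" by (simp add: pr_def initial_store_def int_prec)
  have "(0::int) \<le> 2 ^ (2 * Z)" by simp
  then show "int R \<le> B" unfolding B_def by linarith
qed (rule inp_nonneg)

lemma length_rationals_cnt: "length (rationals I) = cnt"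
  by (simp add: length_rationals cnt_def n_mult_m)

lemma Z_eq: "Z = (\<Sum>i<length enc. bits (enc ! i))"
  by (simp add: input_size_def sum_list_sum_nth atLeast0LessThan)

lemma length_enc_le: "length enc \<le> Z"
proof -
  have "(\<Sum>i<length enc. 1) \<le> (\<Sum>i<length enc. bits (enc ! i))"
    by (intro sum_mono) (simp add: Suc_leI)
  then show ?thesis by (simp add: Z_eq)
qed

lemma cnt_le_Z: "cnt \<le> Z"
  using length_enc_le by (simp add: length_enc length_rationals_cnt)

lemma enc_le: "i < length enc \<Longrightarrow> enc ! i \<le> 2 ^ Z"
proof -
  assume i: "i < length enc"
  have "bits (enc ! i) \<le> Z"
    unfolding Z_eq using member_le_sum[of i "{..<length enc}" "\<lambda>i. bits (enc ! i)"] i by simp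
  then have "(2::int) ^ bits (enc ! i) \<le> 2 ^ Z" by (intro power_increasing) auto
  with abs_le_power_bits[of "enc ! i"] show ?thesis by linarith
qed

lemma den_pos: "i < cnt \<Longrightarrow> 0 < inp (3 + 2 * int i)"
  using inp_den[of i] quotient_of_denom_pos' by (simp add: length_rationals_cnt)

lemma dens_pos: "i \<le> cnt \<Longrightarrow> 0 < dens i"
  unfolding dens_def by (intro prod_pos) (auto intro: den_pos)

text \<open>Denominators occupy distinct input cells, so the length of their product is bounded by
  the sum of their lengths and hence by the input size.\<close>

lemma dens_le_Z: "i \<le> cnt \<Longrightarrow> dens i \<le> 2 ^ Z"
proof -
  assume i: "i \<le> cnt"
  have eq: "inp (3 + 2 * int j) = enc ! (3 + 2 * j)" if "j < cnt" for j
    using inp_nth[of "3 + 2 * j"] that by (simp add: length_enc length_rationals_cnt)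
  have "dens i \<le> (\<Prod>j<i. 2 ^ bits (enc ! (3 + 2 * j)))"
    unfolding dens_def
  proof (intro prod_mono conjI)
    fix j assume "j \<in> {..<i}"
    then have j: "j < cnt" using i by simp
    show "0 \<le> inp (3 + 2 * int j)" using den_pos[OF j] by simp
    show "inp (3 + 2 * int j) \<le> 2 ^ bits (enc ! (3 + 2 * j))"
      using abs_le_power_bits[of "enc ! (3 + 2 * j)"] eq[OF j] by linarith
  qed
  also have "\<dots> = 2 ^ (\<Sum>j<i. bits (enc ! (3 + 2 * j)))" by (simp add: power_sum)
  also have "\<dots> \<le> 2 ^ Z"
  proof (intro power_increasing)
    have "(\<Sum>j<i. bits (enc ! (3 + 2 * j))) = (\<Sum>j\<in>(\<lambda>j. 3 + 2 * j) ` {..<i}. bits (enc ! j))"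
      by (subst sum.reindex) (auto simp: inj_on_def)
    also have "\<dots> \<le> Z"
      unfolding Z_eq using i by (intro sum_mono2) (auto simp: length_enc length_rationals_cnt)
    finally show "(\<Sum>j<i. bits (enc ! (3 + 2 * j))) \<le> Z" .
  qed simp
  finally show ?thesis .
qed

text \<open>Each denominator is a factor of the common one, so the integer division is exact and
  scaling loses nothing.\<close>

lemma scaled_eq:
  assumes "i < cnt"
  shows "real_of_int (scaled i) = real_of_int (dens cnt) * real_of_rat (rationals I ! i)"
proof -
  obtain a b where ab: "quotient_of (rationals I ! i) = (a, b)" by force
  then have inp: "inp (2 + 2 * int i) = a" "inp (3 + 2 * int i) = b"
    using inp_num[of i] inp_den[of i] assms by (simp_all add: length_rationals_cnt)
  have b: "0 < b" by (rule quotient_of_denom_pos[OF ab])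
  have "b dvd dens cnt" unfolding dens_def inp(2)[symmetric] by (rule dvd_prodI) (use assms in auto)
  then obtain c where c: "dens cnt = b * c" by (elim dvdE)
  have "scaled i = a * c" using b by (simp add: scaled_def inp c)
  moreover have "real_of_rat (rationals I ! i) = real_of_int a / real_of_int b"
    unfolding quotient_of_div[OF ab] by (simp add: of_rat_divide)
  ultimately show ?thesis using b by (simp add: c)
qed

lemma scaled_le_Z:
  assumes "i < cnt"
  shows "scaled i \<le> 2 ^ (2 * Z)"
proof -
  have "inp (2 + 2 * int i) \<le> 2 ^ Z"
    using inp_nth[of "2 + 2 * i"] enc_le[of "2 + 2 * i"] assms by (simp add: length_enc length_rationals_cnt)
  moreover have "0 \<le> inp (2 + 2 * int i)" using inp_nonneg[of "2 + 2 * i"] by simp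
  ultimately have "inp (2 + 2 * int i) * dens cnt \<le> 2 ^ Z * 2 ^ Z"
    using dens_le_Z[of cnt] dens_pos[of cnt] by (intro mult_mono) auto
  moreover have "scaled i \<le> inp (2 + 2 * int i) * dens cnt"
    unfolding scaled_def
    using zdiv_mono2[of "inp (2 + 2 * int i) * dens cnt" 1 "inp (3 + 2 * int i)"]
      \<open>0 \<le> inp (2 + 2 * int i)\<close> den_pos[OF assms] dens_pos[of cnt] by simp
  moreover have "(2::int) ^ (2 * Z) = 2 ^ Z * 2 ^ Z" by (simp add: mult_2 power_add)
  ultimately show ?thesis by linarith
qed

section \<open>Polynomial bounds for the resources\<close>

lemma x_pos: "1 \<le> x"
  by (simp add: x_def)

text \<open>Everything follows from \<open>G \<le> 4 * x ^ 3\<close>. The exponents arise as 6 for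
  \<open>G * G\<close>, 7 for \<open>H\<close>, 15 for \<open>rounds\<close> (about
  \<open>n * H * H\<close>), 22 for \<open>ymax\<close> (about \<open>rounds * H\<close>), and 30
  after the factors \<open>n\<close>, \<open>G * G\<close> and \<open>m\<close>.\<close>

lemma poly_bounds:
  "G * G \<le> 16 * int x ^ 6" "H \<le> 16 * int x ^ 7" "int rounds \<le> 259 * int x ^ 15"
  "ymax \<le> 4145 * int x ^ 22" "int n * ymax \<le> 4145 * int x ^ 23"
  "int n * (ymax * (G * G)) \<le> 66320 * int x ^ 29"
  "int m * (int n * (ymax * (G * G))) \<le> 66320 * int x ^ 30" "int n \<le> int x" "int m \<le> int x"
proof -
  define X where "X = int x"
  have X: "1 \<le> X" using x_pos by (simp add: X_def)
  have pw: "X ^ i \<le> X ^ j" if "i \<le> j" for i j using power_increasing[OF that X] .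
  have m: "int m \<le> X" using cnt_le_Z by (simp add: X_def x_def cnt_def)
  have n: "int n \<le> X"
  proof (cases "m = 0")
    case False
    then have "n \<le> n * m" by simp
    then have "n \<le> Z" using cnt_le_Z unfolding cnt_def by linarith
    then show ?thesis by (simp add: X_def x_def)
  qed (use X in \<open>simp add: n_def\<close>)
  have prec: "int prec \<le> X" by (simp add: X_def x_def)
  have "4 * int prec * (int n * int m) \<le> 4 * X * (X * X)"
    using m n prec X by (intro mult_mono) auto
  then have G: "G \<le> 4 * X ^ 3" by (simp add: G_def power3_eq_cube mult.assoc)
  have "G * G \<le> (4 * X ^ 3) * (4 * X ^ 3)" by (rule mult_mono) (use G G_nonneg X in auto)
  also have "\<dots> = 16 * X ^ 6" by (simp add: power_add[symmetric])
  finally have GG: "G * G \<le> 16 * X ^ 6" .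
  have "int m * (G * G) \<le> X * (16 * X ^ 6)" by (rule mult_mono) (use m GG X G_nonneg in auto)
  also have "\<dots> = 16 * X ^ 7" by (simp add: power_Suc[symmetric])
  finally have H: "H \<le> 16 * X ^ 7" by (simp add: H_def)
  have "H * H \<le> (16 * X ^ 7) * (16 * X ^ 7)" by (rule mult_mono) (use H H_nonneg X in auto)
  also have "\<dots> = 256 * X ^ 14" by (simp add: power_add[symmetric])
  finally have HH: "H * H + 2 \<le> 258 * X ^ 14" using pw[of 0 14] by simp
  have "int n * (H * H + 2) \<le> X * (258 * X ^ 14)" by (rule mult_mono) (use n HH X in auto)
  also have "\<dots> = 258 * X ^ 15" by (simp add: power_Suc[symmetric])
  finally have T: "int rounds \<le> 259 * X ^ 15" using pw[of 0 15] by (simp add: int_rounds)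
  have "int rounds * H \<le> (259 * X ^ 15) * (16 * X ^ 7)" by (rule mult_mono) (use T H H_nonneg X in auto)
  also have "\<dots> = 4144 * X ^ 22" by (simp add: power_add[symmetric])
  finally have y: "ymax \<le> 4145 * X ^ 22" using pw[of 0 22] by simp
  have y0: "0 \<le> ymax" using H_nonneg by simp
  have "int n * ymax \<le> X * (4145 * X ^ 22)" by (rule mult_mono) (use n y y0 X in auto)
  also have "\<dots> = 4145 * X ^ 23" by (simp add: power_Suc[symmetric])
  finally have ny: "int n * ymax \<le> 4145 * X ^ 23" .
  have "(int n * ymax) * (G * G) \<le> (4145 * X ^ 23) * (16 * X ^ 6)"
    by (rule mult_mono) (use ny GG y0 X in auto)
  also have "\<dots> = 66320 * X ^ 29" by (simp add: power_add[symmetric])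
  finally have w: "int n * (ymax * (G * G)) \<le> 66320 * X ^ 29" by (simp add: mult.assoc)
  have w0: "0 \<le> int n * (ymax * (G * G))" using y0 by simp
  have "int m * (int n * (ymax * (G * G))) \<le> X * (66320 * X ^ 29)"
    by (rule mult_mono) (use m w w0 X in auto)
  also have "\<dots> = 66320 * X ^ 30" by (simp add: power_Suc[symmetric])
  finally have t: "int m * (int n * (ymax * (G * G))) \<le> 66320 * X ^ 30" .
  show "G * G \<le> 16 * int x ^ 6" "H \<le> 16 * int x ^ 7" "int rounds \<le> 259 * int x ^ 15"
    "ymax \<le> 4145 * int x ^ 22" "int n * ymax \<le> 4145 * int x ^ 23"
    "int n * (ymax * (G * G)) \<le> 66320 * int x ^ 29"
    "int m * (int n * (ymax * (G * G))) \<le> 66320 * int x ^ 30" "int n \<le> int x" "int m \<le> int x"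
    using GG H T y ny w t n m unfolding X_def by simp_all
qed

lemma le_R: "a \<le> c * int x ^ i \<Longrightarrow> c \<le> 66321 \<Longrightarrow> i \<le> 30 \<Longrightarrow> a \<le> int R"
proof -
  assume a: "a \<le> c * int x ^ i" and c: "c \<le> 66321" and i: "i \<le> 30"
  have "int x ^ i \<le> int x ^ 30" using x_pos i by (intro power_increasing) auto
  then have "c * int x ^ i \<le> 66321 * int x ^ 30"
    using c by (intro mult_mono) auto
  with a show ?thesis by (simp add: R_def)
qed

lemma x_le_R: "int x \<le> int R"
  by (rule le_R[of _ 1 1]) auto

sublocale bounded_fptas_run R B inp pr n m prec
proof
  have Z2: "(2::int) ^ Z \<le> 2 ^ (2 * Z)" by (intro power_increasing) auto
  show "dens i \<le> B" if "i \<le> cnt" for i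
    using dens_le_Z[OF that] Z2 unfolding B_def by linarith
  show "scaled i < B" if "i < cnt" for i
    using scaled_le_Z[OF that] unfolding B_def by linarith
  show "cnt \<le> R" using cnt_le_Z x_le_R by (simp add: x_def)
  show "n \<le> R" using poly_bounds(8) x_le_R by linarith
  have "int rounds \<le> int R" by (rule le_R[OF poly_bounds(3)]) auto
  then show "rounds \<le> R" by simp
  show "G * G \<le> int R" by (rule le_R[OF poly_bounds(1)]) auto
  show "H \<le> int R" by (rule le_R[OF poly_bounds(2)]) auto
  show "ymax \<le> int R" by (rule le_R[OF poly_bounds(4)]) auto
  show "int n * ymax \<le> int R" by (rule le_R[OF poly_bounds(5)]) auto
  show "int n * (ymax * (G * G)) \<le> int R" by (rule le_R[OF poly_bounds(6)]) auto
  have "0 < int x ^ 30" using x_pos by simp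
  moreover have "int R = 66321 * int x ^ 30" by (simp add: R_def)
  ultimately show "int m * (int n * (ymax * (G * G))) < int R"
    using poly_bounds(7) by linarith
qed

lemma bounded_initial_store: "bounded_store (initial_store I \<epsilon>)"
  unfolding bounded_store_def
proof (intro allI)
  fix a i
  have Z2: "(2::int) ^ Z \<le> 2 ^ (2 * Z)" by (intro power_increasing) auto
  consider "a = ''input''" "0 \<le> i" "i < int (length enc)" | "a = ''precision''" "i = 0" |
    "\<not> (a = ''input'' \<and> 0 \<le> i \<and> i < int (length enc))" "\<not> (a = ''precision'' \<and> i = 0)"
    by blast
  then show "\<bar>initial_store I \<epsilon> a i\<bar> \<le> B"
  proof cases
    case 1
    then have lt: "nat i < length enc" by auto
    then have "initial_store I \<epsilon> a i = enc ! nat i" "0 \<le> enc ! nat i"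
      using 1 by (auto simp: initial_store_def intro!: enc_nonneg)
    with enc_le[OF lt] Z2 show ?thesis unfolding B_def by linarith
  next
    case 2
    then have "initial_store I \<epsilon> a i = int prec" by (simp add: initial_store_def int_prec)
    moreover have "int prec \<le> int x" by (simp add: x_def)
    ultimately show ?thesis using x_le_R R_le_B by linarith
  next
    case 3
    then have "initial_store I \<epsilon> a i = 0" unfolding initial_store_def by (simp only: if_False)
    then show ?thesis using B_nonneg by simp
  qed
qed

text \<open>The exponential part of \<open>B\<close> has length linear in the input size; for the
  other part the crude bound \<open>R + 1 < 2 ^ (R + 1)\<close> is enough. The sum
  \<open>3 * R + 4\<close> is at most \<open>7 * R\<close>.\<close>

lemma bits_B_le: "bits B \<le> 7 * R"
proof -
  have "(1::int) \<le> int x" using x_pos by simp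
  then have R1: "1 \<le> R" using x_le_R by linarith
  have "bits B \<le> bits (2 ^ (2 * Z)) + bits (int R + 1)" unfolding B_def by (rule bits_add)
  moreover have "bits (2 ^ (2 * Z)) \<le> Suc (2 * Z + 1)" by (subst bits_le_iff) simp
  moreover have "bits (int R + 1) \<le> Suc (R + 1)"
  proof (subst bits_le_iff)
    have "R + 1 < 2 ^ (R + 1)" by (rule less_exp)
    then have "int (R + 1) < int (2 ^ (R + 1))" by (simp only: of_nat_less_iff)
    then show "\<bar>int R + 1\<bar> < 2 ^ (R + 1)" by simp
  qed
  moreover have "Z \<le> R" using x_le_R by (simp add: x_def)
  ultimately show ?thesis using R1 by linarith
qed

section \<open>The output distribution and its quality\<close>

definition solution :: "nat set pmf" where
  "solution = map_pmf (\<lambda>i. choice (deficit i)) (pmf_of_set {..<rounds})"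

lemma finite_feasible_sets: "finite (feasible_sets I)"
  by (rule finite_subset[of _ "Pow {..<items I}"]) (auto simp: feasible_sets_def)

text \<open>Sizes and capacity were multiplied by the same positive number.\<close>

lemma feasible_iff: "feasible S \<longleftrightarrow> S \<in> feasible_sets I"
proof (cases "S \<subseteq> {..<m}")
  case True
  have "real_of_int (scaled (Suc e)) = real_of_int (dens cnt) * real_of_rat (item_size I e)" if "e \<in> S" for e
    using scaled_eq[of "Suc e"] nth_rationals(2)[of e I] True that by (auto simp: cnt_def)
  then have "real_of_int (\<Sum>e\<in>S. scaled (Suc e)) = real_of_int (dens cnt) * real_of_rat (\<Sum>e\<in>S. item_size I e)"
    by (simp add: of_rat_sum sum_distrib_left)
  moreover have "real_of_int (scaled 0) = real_of_int (dens cnt) * real_of_rat (capacity I)"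
    using scaled_eq[of 0] nth_rationals(1)[of I] by (simp add: cnt_def)
  moreover have "0 < real_of_int (dens cnt)" using dens_pos[of cnt] by simp
  ultimately have "(\<Sum>e\<in>S. scaled (Suc e)) \<le> scaled 0 \<longleftrightarrow> (\<Sum>e\<in>S. item_size I e) \<le> capacity I"
    by (metis mult_le_cancel_left_pos of_int_le_iff of_rat_less_eq)
  then show ?thesis using True by (simp add: feasible_def feasible_sets_def)
qed (auto simp: feasible_def feasible_sets_def)

lemma objective_eq:
  assumes "k < objectives I" "S \<subseteq> {..<m}"
  shows "real_of_int (sum (wt k) S) = real_of_int (dens cnt) * objective I k S"
proof -
  have "real_of_int (wt k e) = real_of_int (dens cnt) * real_of_rat (weight I k e)" if "e \<in> S" for e
  proof -
    have e: "e < m" using assms(2) that by auto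
    then have "Suc (m + (k * m + e)) < cnt"
      using flat_index_less[OF assms(1) e] by (simp add: cnt_def n_mult_m)
    from scaled_eq[OF this] show ?thesis using nth_rationals(3)[OF assms(1) e] by simp
  qed
  then show ?thesis by (simp add: objective_def sum_distrib_left)
qed

lemma solution_in_distributions: "solution \<in> distributions I"
  using rounds_pos choice_feasible[OF deficit_nonneg]
  by (auto simp: distributions_def solution_def feasible_iff[symmetric])

text \<open>The expectation over a uniformly random round is an average over rounds; the factor
  \<open>dens cnt\<close> converts rational weights into the scaled ones.\<close>

lemma solution_value:
  assumes k: "k < objectives I"
  shows "real_of_int (dens cnt) * (\<Sum>S\<in>feasible_sets I. pmf solution S * objective I k S) = average k"
proof -
  have fin: "finite {..<rounds}" "{..<rounds} \<noteq> {}" using rounds_pos by auto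
  have "(\<Sum>S\<in>feasible_sets I. pmf solution S * objective I k S)
      = measure_pmf.expectation solution (objective I k)"
    using solution_in_distributions finite_feasible_sets
    by (subst integral_measure_pmf_real[of "feasible_sets I"])
      (auto simp: distributions_def mult.commute)
  also have "\<dots> = (\<Sum>i<rounds. objective I k (choice (deficit i))) / real rounds"
    unfolding solution_def integral_map_pmf using integral_pmf_of_set[OF fin(2,1)] by simp
  finally have "real_of_int (dens cnt) * (\<Sum>S\<in>feasible_sets I. pmf solution S * objective I k S)
      = (\<Sum>i<rounds. real_of_int (dens cnt) * objective I k (choice (deficit i))) / real rounds"
    by (simp add: sum_distrib_left)
  also have "\<dots> = average k"
    unfolding average_def using objective_eq[OF k choice_subset] by simp
  finally show ?thesis .
qed

lemma worst_case_le:
  "k < objectives I \<Longrightarrow> worst_case I q \<le> (\<Sum>S\<in>feasible_sets I. pmf q S * objective I k S)"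
  unfolding worst_case_def by (intro Min_le) auto

lemma objective_nonneg: "k < objectives I \<Longrightarrow> S \<in> feasible_sets I \<Longrightarrow> 0 \<le> objective I k S"
  using valid unfolding objective_def valid_instance_def feasible_sets_def
  by (intro sum_nonneg) auto

lemma worst_case_ge:
  "(\<And>k. k < objectives I \<Longrightarrow> c \<le> (\<Sum>S\<in>feasible_sets I. pmf q S * objective I k S)) \<Longrightarrow> c \<le> worst_case I q"
  using valid unfolding worst_case_def valid_instance_def
  by (subst Min_ge_iff) (auto simp: lessThan_empty_iff)

lemma worst_case_nonneg: "0 \<le> worst_case I q"
  by (intro worst_case_ge sum_nonneg mult_nonneg_nonneg objective_nonneg) auto

lemma solution_optimal:
  assumes q: "q \<in> distributions I"
  shows "(1 - 1 / real prec) * worst_case I q \<le> worst_case I solution"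
proof (rule worst_case_ge)
  fix k assume k: "k < objectives I"
  let ?D = "real_of_int (dens cnt)"
  have D: "0 < ?D" using dens_pos[of cnt] by simp
  show "(1 - 1 / real prec) * worst_case I q \<le> (\<Sum>S\<in>feasible_sets I. pmf solution S * objective I k S)"
  proof (cases "m = 0")
    case True
    \<comment> \<open>Without items the program works with \<open>n = 0\<close> although objectives
      exist, so this case is settled directly: only the empty set is available.\<close>
    then have "objective I k S = 0" if "S \<in> feasible_sets I" for S
      using that by (simp add: feasible_sets_def objective_def)
    with worst_case_le[OF k, of q] worst_case_nonneg[of q] have "worst_case I q = 0" by simp
    then show ?thesis
      using k by (auto intro!: sum_nonneg mult_nonneg_nonneg objective_nonneg)
  next
    case False
    then have n: "n = objectives I" by (simp add: n_eq)
    have F: "{S. feasible S} = feasible_sets I" by (auto simp: feasible_iff)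
    have "(1 - 1 / real prec) * (?D * worst_case I q) \<le> average k"
    proof (rule average_optimal[where p = "pmf q"])
      show "(\<Sum>S | feasible S. pmf q S) = 1"
        unfolding F using q finite_feasible_sets by (intro sum_pmf_eq_1) (auto simp: distributions_def)
      fix j assume j: "j < n"
      have "?D * worst_case I q \<le> ?D * (\<Sum>S\<in>feasible_sets I. pmf q S * objective I j S)"
        using D worst_case_le[of j q] j n by simp
      also have "\<dots> = (\<Sum>S\<in>feasible_sets I. pmf q S * (?D * objective I j S))"
        by (simp add: sum_distrib_left mult.left_commute)
      also have "\<dots> = (\<Sum>S\<in>feasible_sets I. pmf q S * real_of_int (sum (wt j) S))"
        using objective_eq[of j] j n by (intro sum.cong) (auto simp: feasible_sets_def simp del: of_int_sum)
      finally show "?D * worst_case I q \<le> (\<Sum>S | feasible S. pmf q S * real_of_int (sum (wt j) S))"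
        unfolding F .
    qed (use prec_pos k n in auto)
    then have "?D * ((1 - 1 / real prec) * worst_case I q)
        \<le> ?D * (\<Sum>S\<in>feasible_sets I. pmf solution S * objective I k S)"
      unfolding solution_value[OF k] by (simp add: mult.left_commute)
    then show ?thesis using D by simp
  qed
qed

text \<open>For \<epsilon> below 1 the comparison with each single distribution passes to the
  supremum; otherwise the left side is nonpositive and nonnegativity of weights suffices.\<close>

lemma solution_approximates: "(1 - \<epsilon>) * optimum I \<le> worst_case I solution"
proof (cases "\<epsilon> < 1")
  case True
  have "worst_case I q \<le> worst_case I solution / (1 - \<epsilon>)" if "q \<in> distributions I" for q
  proof -
    have "(1 - \<epsilon>) * worst_case I q \<le> (1 - 1 / real prec) * worst_case I q"
      using prec_bounds(1) worst_case_nonneg by (intro mult_right_mono) auto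
    with solution_optimal[OF that] True show ?thesis by (simp add: pos_le_divide_eq mult.commute)
  qed
  then have "optimum I \<le> worst_case I solution / (1 - \<epsilon>)"
    unfolding optimum_def using solution_in_distributions by (intro cSUP_least) auto
  with True show ?thesis by (simp add: pos_le_divide_eq mult.commute)
next
  case False
  have "0 \<le> optimum I"
    using worst_case_le_optimum[OF valid solution_in_distributions] worst_case_nonneg[of solution] by linarith
  with False have "(1 - \<epsilon>) * optimum I \<le> 0" by (intro mult_nonpos_nonneg) auto
  with worst_case_nonneg[of solution] show ?thesis by linarith
qed

lemma output_correct:
  assumes "stored s ''output'' (Suc (rounds * (m + 2))) output_cells"
  shows "outputs_distribution I s solution"
proof -
  have cell: "entry_cell I s i j = output_cells (Suc (i * (m + 2) + j))" if "i < rounds" "j < m + 2" for i j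
    unfolding entry_cell_def
    by (rule stored_read[OF assms]) (use flat_index_less[OF that] in auto)
  have cells: "entry_cell I s i 0 = 1" "entry_cell I s i 1 = int rounds"
    "\<And>e. e < m \<Longrightarrow> entry_cell I s i (2 + e) = of_bool (e \<in> choice (deficit i))" if "i < rounds" for i
    using cell[OF that, of 0] cell[OF that, of 1] cell[OF that, of "2 + _"] output_cells_entry[where t = i]
    by simp_all
  have set: "entry_set I s i = choice (deficit i)" if "i < rounds" for i
    using cells(3)[OF that] choice_subset[of i] by (auto simp: entry_set_def)
  have prob: "entry_prob I s i = 1 / real rounds" if "i < rounds" for i
    using cells[OF that] by (simp add: entry_prob_def)
  have pmf: "pmf solution S = (\<Sum>i | i < rounds \<and> entry_set I s i = S. entry_prob I s i)" for S
  proof -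
    have fin: "finite {..<rounds}" "{..<rounds} \<noteq> {}" using rounds_pos by auto
    have "pmf solution S = real (card ({..<rounds} \<inter> (\<lambda>i. choice (deficit i)) -` {S})) / real rounds"
      unfolding solution_def pmf_map using measure_pmf_of_set[OF fin(2,1)] by simp
    also have "{..<rounds} \<inter> (\<lambda>i. choice (deficit i)) -` {S} = {i. i < rounds \<and> entry_set I s i = S}"
      using set by auto
    also have "real (card {i. i < rounds \<and> entry_set I s i = S}) / real rounds
        = (\<Sum>i | i < rounds \<and> entry_set I s i = S. entry_prob I s i)"
      using prob by simp
    finally show ?thesis .
  qed
  have "s ''output'' 0 = int rounds"
    using stored_read[OF assms, of 0 0] by (simp add: output_cells_0)
  with cells pmf rounds_pos show ?thesis
    unfolding outputs_distribution_def by (intro exI[of _ rounds]) auto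
qed

lemma fptas_run:
  "\<exists>t s. exec fptas (initial_store I \<epsilon>) t s \<and>
     t \<le> ctime 0 1 fptas * (Suc R ^ nesting fptas * (7 * R)\<^sup>2) \<and> outputs_distribution I s solution"
proof -
  have "wp fptas (\<lambda>s'. stored s' ''output'' (Suc (rounds * (m + 2))) output_cells) (initial_store I \<epsilon>)"
    by (rule wp_fptas) (auto simp: inp_def pr_def)
  then obtain t s where t: "exec fptas (initial_store I \<epsilon>) t s" "t \<le> ctime R (bits B) fptas"
    "stored s ''output'' (Suc (rounds * (m + 2))) output_cells"
    using bounded_initial_store unfolding wp_def by auto
  have "ctime R (bits B) fptas \<le> ctime 0 1 fptas * (Suc R ^ nesting fptas * (bits B)\<^sup>2)"
    by (rule ctime_poly) (simp add: Suc_leI)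
  also have "\<dots> \<le> ctime 0 1 fptas * (Suc R ^ nesting fptas * (7 * R)\<^sup>2)"
    by (intro mult_le_mono le_refl power_mono bits_B_le) simp
  finally show ?thesis using t output_correct by (meson le_trans)
qed

text \<open>Rounding 1/\<epsilon> up adds at most 1, which the factor 2 absorbs.\<close>

lemma x_le: "real x \<le> 2 * (1 + real Z + 1 / \<epsilon>)"
proof -
  define u where "u = 1 / \<epsilon>"
  have "0 \<le> u" using eps by (simp add: u_def)
  moreover have "real prec \<le> u + 1" using prec_bounds(2) by (simp add: u_def)
  ultimately have "1 + real Z + real prec \<le> 2 * (1 + real Z + u)" by simp
  then show ?thesis by (simp add: x_def u_def)
qed

end

theorem mainTheorem10: "\<exists>c. is_robust_knapsack_fptas c"
proof
  define N where "N = nesting fptas"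
  \<comment> \<open>Collects the constants from \<open>Suc R \<le> 2 * R\<close>, from the square of
    \<open>7 * R\<close>, and from \<open>R = 66321 * x ^ 30\<close>, where \<open>R\<close> occurs
    to the power \<open>N + 2\<close>.\<close>
  define c where "c = real (ctime 0 1 fptas) * (2 ^ N * 49 * 66321 ^ (N + 2))"
  show "is_robust_knapsack_fptas fptas"
    unfolding is_robust_knapsack_fptas_def
  proof (rule exI[of _ "c * 2 ^ (30 * (N + 2))"], rule exI[of _ "30 * (N + 2)"], intro allI impI)
    fix I \<epsilon> assume "valid_instance I" "(0::real) < \<epsilon>"
    then interpret valid_input I \<epsilon> by unfold_locales
    obtain t s where t: "exec fptas (initial_store I \<epsilon>) t s"
      "t \<le> ctime 0 1 fptas * (Suc R ^ nesting fptas * (7 * R)\<^sup>2)" "outputs_distribution I s solution"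
      using fptas_run by blast
    let ?y = "1 + real (input_size I) + 1 / \<epsilon>"
    have R1: "1 \<le> R" using x_pos x_le_R by linarith
    have "Suc R ^ N * (7 * R)\<^sup>2 \<le> (2 * R) ^ N * (7 * R)\<^sup>2"
      using R1 by (intro mult_le_mono power_mono) auto
    also have "\<dots> = 2 ^ N * 49 * R ^ (N + 2)"
      by (simp add: power_mult_distrib power_add power2_eq_square)
    also have "\<dots> = 2 ^ N * 49 * 66321 ^ (N + 2) * x ^ (30 * (N + 2))"
      unfolding R_def power_mult_distrib power_mult by simp
    finally have le: "Suc R ^ N * (7 * R)\<^sup>2 \<le> 2 ^ N * 49 * 66321 ^ (N + 2) * x ^ (30 * (N + 2))" .
    from order_trans[OF t(2)[folded N_def] mult_le_mono2[OF le]]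
    have "t \<le> ctime 0 1 fptas * (2 ^ N * 49 * 66321 ^ (N + 2) * x ^ (30 * (N + 2)))" .
    then have "real t \<le> real (ctime 0 1 fptas * (2 ^ N * 49 * 66321 ^ (N + 2) * x ^ (30 * (N + 2))))"
      by (simp only: of_nat_le_iff)
    also have "\<dots> = c * real x ^ (30 * (N + 2))"
      unfolding c_def by (simp only: of_nat_mult of_nat_power of_nat_numeral mult.assoc)
    also have "\<dots> \<le> c * (2 * ?y) ^ (30 * (N + 2))"
      using x_le by (intro mult_left_mono power_mono) (auto simp: c_def)
    also have "\<dots> = c * 2 ^ (30 * (N + 2)) * ?y ^ (30 * (N + 2))"
      by (simp only: power_mult_distrib mult.assoc)
    finally show "\<exists>t s p. exec fptas (initial_store I \<epsilon>) t s \<and>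
        real t \<le> c * 2 ^ (30 * (N + 2)) * ?y ^ (30 * (N + 2)) \<and>
        outputs_distribution I s p \<and> p \<in> distributions I \<and> worst_case I p \<ge> (1 - \<epsilon>) * optimum I"
      using t(1,3) solution_in_distributions solution_approximates by blast
  qed
qed

end
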